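(* Let $\varphi,\psi\colon\mathbb R_+\to\mathbb R_+$ be Borel functions. Let $A$ be a closed densely defined operator in a complex Hilbert space $\mathcal H$, let $E$ be the spectral measure of $|A|$ and let $c\in\mathbb R_+$. Then the following conditions are equivalent: (i) $\langle E(\varphi^{-1}(\cdot))|A|f,|A|f\rangle\leqslant c\,\langle E(\psi^{-1}(\cdot))Af,Af\rangle$ for all $f\in\mathcal D(A)$; (ii) there exists $T\in\boldsymbol B(\mathcal H)$ such that $TA=|A|$, $\|T\|\leqslant\sqrt c$ and $TE(\psi^{-1}(\cdot))=E(\varphi^{-1}(\cdot))T$; (iii) there exists $T\in\boldsymbol B(\mathcal H)$ such that $TA=|A|$, $\|T\|\leqslant\sqrt c$ and $T\psi(|A|)\subseteq\varphi(|A|)T$.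
   Context: All operators are linear and possibly unbounded; $\mathcal D(A)$ denotes the domain of $A$; $\boldsymbol B(\mathcal H)$ is the algebra of bounded operators with domain $\mathcal H$. $\mathbb R_+=[0,\infty)$ and $\mathfrak B(\mathbb R_+)$ is its Borel $\sigma$-algebra. For a closed densely defined $A$, $|A|$ is the square root of the positive selfadjoint operator $A^*A$, and its spectral measure is regarded as defined on $\mathfrak B(\mathbb R_+)$. $E(\varphi^{-1}(\cdot))$ stands for the spectral measure $\sigma\mapsto E(\varphi^{-1}(\sigma))$ on $\mathfrak B(\mathbb R_+)$, and similarly for $\psi$; relations involving $(\cdot)$ are understood to hold for every $\sigma\in\mathfrak B(\mathbb R_+)$ (the same $\sigma$ on both sides). $\varphi(|A|)$ and $\psi(|A|)$ are given by the Borel functional calculus. $S\subseteq T$ means $\mathcal D(S)\subseteq\mathcal D(T)$ and $Sf=Tf$ for $f\in\mathcal D(S)$. *)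

theory Defs
  imports "HOL-Analysis.Analysis"
begin

text \<open>The inner product is linear in its first argument. The norm is tied to the inner product
  by \<open>cinner_norm\<close>, and completeness comes from \<^class>\<open>banach\<close>.\<close>

class chilbert_space = banach +
  fixes scaleC :: "complex \<Rightarrow> 'a \<Rightarrow> 'a"  (infixr "*\<^sub>C" 75)
    and cinner :: "'a \<Rightarrow> 'a \<Rightarrow> complex"
  assumes scaleC_add_right: "a *\<^sub>C (x + y) = a *\<^sub>C x + a *\<^sub>C y"
    and scaleC_add_left: "(a + b) *\<^sub>C x = a *\<^sub>C x + b *\<^sub>C x"
    and scaleC_scaleC: "a *\<^sub>C b *\<^sub>C x = (a * b) *\<^sub>C x"
    and scaleR_scaleC: "r *\<^sub>R x = complex_of_real r *\<^sub>C x"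
    and cinner_add_left: "cinner (x + y) z = cinner x z + cinner y z"
    and cinner_scaleC_left: "cinner (a *\<^sub>C x) y = a * cinner x y"
    and cinner_commute: "cinner x y = cnj (cinner y x)"
    and cinner_norm: "cinner x x = complex_of_real ((norm x)\<^sup>2)"

instantiation complex :: chilbert_space
begin

definition scaleC_complex :: "complex \<Rightarrow> complex \<Rightarrow> complex" where
  "scaleC_complex a x = a * x"

definition cinner_complex :: "complex \<Rightarrow> complex \<Rightarrow> complex" where
  "cinner_complex x y = x * cnj y"

instance
  by standard
    (simp_all add: scaleC_complex_def cinner_complex_def algebra_simps scaleR_conv_of_real
      complex_norm_square[symmetric])

end

definition bounded_clinear :: "('a::chilbert_space \<Rightarrow> 'a) \<Rightarrow> bool" where
  "bounded_clinear T \<longleftrightarrow> bounded_linear T \<and> (\<forall>a x. T (a *\<^sub>C x) = a *\<^sub>C T x)"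

text \<open>A possibly unbounded operator is represented by its graph. Thus the domain is
  \<^const>\<open>Domain\<close>, and \<open>S \<subseteq> T\<close> and \<open>S = T\<close> have their usual meaning for operators.\<close>

type_synonym 'a op_graph = "('a \<times> 'a) set"

definition linear_op :: "'a::chilbert_space op_graph \<Rightarrow> bool" where
  "linear_op A \<longleftrightarrow> single_valued A \<and> (0, 0) \<in> A
     \<and> (\<forall>f g h k. (f, g) \<in> A \<longrightarrow> (h, k) \<in> A \<longrightarrow> (f + h, g + k) \<in> A)
     \<and> (\<forall>a f g. (f, g) \<in> A \<longrightarrow> (a *\<^sub>C f, a *\<^sub>C g) \<in> A)"

definition op_app :: "'a op_graph \<Rightarrow> 'a \<Rightarrow> 'a" where
  "op_app A f = (THE g. (f, g) \<in> A)"

definition op_comp :: "'a op_graph \<Rightarrow> 'a op_graph \<Rightarrow> 'a op_graph"  (infixl "\<odot>" 70) where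
  "S \<odot> T = T O S"

definition graph_of :: "('a \<Rightarrow> 'a) \<Rightarrow> 'a op_graph" where
  "graph_of T = {(f, T f) | f. True}"

definition densely_defined :: "'a::chilbert_space op_graph \<Rightarrow> bool" where
  "densely_defined A \<longleftrightarrow> closure (Domain A) = UNIV"

definition adj :: "'a::chilbert_space op_graph \<Rightarrow> 'a op_graph" where
  "adj A = {(g, h). \<forall>(f, k) \<in> A. cinner k g = cinner f h}"

definition positive_selfadjoint :: "'a::chilbert_space op_graph \<Rightarrow> bool" where
  "positive_selfadjoint A \<longleftrightarrow> linear_op A \<and> densely_defined A \<and> adj A = A
     \<and> (\<forall>(f, g) \<in> A. 0 \<le> Re (cinner g f))"

text \<open>\<open>is_abs A P\<close> says that \<open>P = |A|\<close>, the positive selfadjoint square root of \<open>A\<^sup>* A\<close>; for closed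
  densely defined \<open>A\<close> there is exactly one such \<open>P\<close>.\<close>

definition is_abs :: "'a::chilbert_space op_graph \<Rightarrow> 'a op_graph \<Rightarrow> bool" where
  "is_abs A P \<longleftrightarrow> positive_selfadjoint P \<and> P \<odot> P = adj A \<odot> A"

abbreviation borel_Rp :: "real measure" where
  "borel_Rp \<equiv> restrict_space borel {0..}"

text \<open>Preimage under a function that is only considered on \<open>[0, \<infinity>)\<close>.\<close>

definition preim :: "(real \<Rightarrow> real) \<Rightarrow> real set \<Rightarrow> real set" where
  "preim \<phi> \<sigma> = \<phi> -` \<sigma> \<inter> {0..}"

definition orth_proj :: "('a::chilbert_space \<Rightarrow> 'a) \<Rightarrow> bool" where
  "orth_proj Q \<longleftrightarrow> bounded_clinear Q \<and> Q \<circ> Q = Q \<and> (\<forall>f g. cinner (Q f) g = cinner f (Q g))"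

text \<open>Only the values of \<open>E\<close> on Borel subsets of \<open>[0, \<infinity>)\<close> matter; countable additivity is
  meant in the strong operator topology.\<close>

definition spectral_measure :: "(real set \<Rightarrow> 'a::chilbert_space \<Rightarrow> 'a) \<Rightarrow> bool" where
  "spectral_measure E \<longleftrightarrow> (\<forall>\<sigma> \<in> sets borel_Rp. orth_proj (E \<sigma>)) \<and> E {0..} = id
     \<and> (\<forall>\<sigma>. range \<sigma> \<subseteq> sets borel_Rp \<longrightarrow> disjoint_family \<sigma> \<longrightarrow>
          (\<forall>f. (\<lambda>n::nat. E (\<sigma> n) f) sums E (\<Union>n. \<sigma> n) f))"

definition scalar_measure :: "(real set \<Rightarrow> 'a::chilbert_space \<Rightarrow> 'a) \<Rightarrow> 'a \<Rightarrow> real measure" where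
  "scalar_measure E f =
     measure_of {0..} (sets borel_Rp) (\<lambda>\<sigma>. ennreal (Re (cinner (E \<sigma> f) f)))"

definition simple_spectral_integral ::
  "(real set \<Rightarrow> 'a::chilbert_space \<Rightarrow> 'a) \<Rightarrow> (real \<Rightarrow> real) \<Rightarrow> 'a \<Rightarrow> 'a" where
  "simple_spectral_integral E s f = (\<Sum>y \<in> s ` {0..}. y *\<^sub>R E (preim s {y}) f)"

text \<open>The operator \<open>\<integral> \<phi> dE\<close>: its domain consists of those \<open>f\<close> with
  \<open>\<integral> |\<phi>|\<^sup>2 d\<langle>E(\<cdot>)f, f\<rangle> < \<infinity>\<close>, and it sends such an \<open>f\<close> to the limit of the vectors
  \<open>(\<integral> s\<^sub>n dE) f\<close>, where the simple functions \<open>s\<^sub>n\<close> converge to \<open>\<phi>\<close> in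
  \<open>L\<^sup>2(\<langle>E(\<cdot>)f, f\<rangle>)\<close>. The limit does not depend on the choice of \<open>s\<^sub>n\<close>, because
  \<open>\<parallel>(\<integral> s dE) f\<parallel>\<^sup>2 = \<integral> |s|\<^sup>2 d\<langle>E(\<cdot>)f, f\<rangle>\<close> for simple \<open>s\<close>.\<close>

definition spectral_integral ::
  "(real set \<Rightarrow> 'a::chilbert_space \<Rightarrow> 'a) \<Rightarrow> (real \<Rightarrow> real) \<Rightarrow> 'a op_graph" where
  "spectral_integral E \<phi> = {(f, g).
     (\<integral>\<^sup>+x. ennreal ((\<phi> x)\<^sup>2) \<partial>scalar_measure E f) < \<infinity> \<and>
     (\<exists>s. (\<forall>n::nat. simple_function borel_Rp (s n)) \<and>
          (\<lambda>n. \<integral>\<^sup>+x. ennreal ((\<phi> x - s n x)\<^sup>2) \<partial>scalar_measure E f) \<longlonglongrightarrow> 0 \<and>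
          (\<lambda>n. simple_spectral_integral E (s n) f) \<longlonglongrightarrow> g)}"

text \<open>Given that \<open>E\<close> is the spectral measure of \<open>P\<close>, the Borel function \<open>\<phi>(P)\<close> of \<open>P\<close> is
  \<open>spectral_integral E \<phi>\<close>.\<close>

definition is_spectral_measure_of ::
  "(real set \<Rightarrow> 'a::chilbert_space \<Rightarrow> 'a) \<Rightarrow> 'a op_graph \<Rightarrow> bool" where
  "is_spectral_measure_of E P \<longleftrightarrow> spectral_measure E \<and> spectral_integral E (\<lambda>x. x) = P"

end

theory Submission
  imports Defs
begin

text \<open>Write \<open>G(\<sigma>) = E(\<psi>\<^sup>-\<^sup>1(\<sigma>))\<close> and \<open>F(\<sigma>) = E(\<phi>\<^sup>-\<^sup>1(\<sigma>))\<close>.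
  Condition (i) bounds \<open>F(\<rho>)|A|f\<close> by \<open>G(\<rho>)Af\<close> for each \<open>\<rho>\<close>. This bound survives pasting: from
  \<open>(u, v)\<close> and \<open>(u', v')\<close> one passes to
  \<open>(G(\<sigma>)u + G(\<sigma>\<^sup>c)u', F(\<sigma>)v + F(\<sigma>\<^sup>c)v')\<close>. The pairs obtained from all \<open>(Af, |A|f)\<close> by pasting
  form a linear relation, which is the graph of a bounded operator intertwining \<open>G\<close> and \<open>F\<close>; extended by \<open>0\<close>
  on the orthogonal complement of its domain, it is the operator \<open>T\<close> of (ii).

  For (ii) \<open>\<longleftrightarrow>\<close> (iii), \<open>\<psi>(|A|)f\<close> is the limit of dyadic sums \<open>\<Sum> y G({r\<^sub>n = y}) f\<close>, and a \<open>T\<close> that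
  intertwines \<open>G\<close> and \<open>F\<close> maps these to the sums for \<open>F\<close>. Conversely, if
  \<open>T\<psi>(|A|) \<subseteq> \<phi>(|A|)T\<close>, then iterating \<open>\<psi>(|A|) - t\<close> and comparing growth rates gives \<open>F(\<tau>)TG(\<sigma>) = 0\<close>
  whenever \<open>\<sigma>\<close> lies closer to \<open>t\<close> than \<open>\<tau>\<close> does; letting \<open>\<sigma>\<close> and \<open>\<tau>\<close> exhaust \<open>[0, a]\<close> and
  \<open>(a, \<infinity>)\<close> yields the intertwining on \<open>[0, a]\<close>, hence on all Borel sets.\<close>

section \<open>Complex Hilbert spaces and orthogonal projections\<close>

lemma cinner_add_right: "cinner x (y + z) = cinner x y + cinner x z"
  by (metis cinner_add_left cinner_commute complex_cnj_add)

lemma cinner_scaleC_right: "cinner x (a *\<^sub>C y) = cnj a * cinner x y"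
  by (metis cinner_scaleC_left cinner_commute complex_cnj_mult)

lemma scaleC_minus_one: "(-1) *\<^sub>C x = - x"
  using scaleR_scaleC[of "-1" x] by simp

lemma scaleC_zero_left [simp]: "0 *\<^sub>C x = 0"
  using scaleR_scaleC[of 0 x] by simp

lemma cinner_scaleR_left: "cinner (r *\<^sub>R x) y = of_real r * cinner x y"
  by (simp add: scaleR_scaleC cinner_scaleC_left)

lemma cinner_scaleR_right: "cinner x (r *\<^sub>R y) = of_real r * cinner x y"
  by (simp add: scaleR_scaleC cinner_scaleC_right)

lemma cinner_zero_left [simp]: "cinner 0 x = 0"
  using cinner_scaleC_left[of 0 0 x] by simp

lemma cinner_zero_right [simp]: "cinner x 0 = 0"
  using cinner_scaleC_right[of x 0 0] by simp

lemma cinner_minus_left: "cinner (- x) y = - cinner x y"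
  using cinner_scaleC_left[of "-1" x y] by (simp add: scaleC_minus_one)

lemma cinner_minus_right: "cinner x (- y) = - cinner x y"
  using cinner_scaleC_right[of x "-1" y] by (simp add: scaleC_minus_one)

lemma cinner_diff_right: "cinner x (y - z) = cinner x y - cinner x z"
  using cinner_add_right[of x y "- z"] by (simp add: cinner_minus_right)

lemma scaleC_diff_right: "a *\<^sub>C (x - y) = a *\<^sub>C x - a *\<^sub>C y"
  for x y :: "'a::chilbert_space"
  by (metis add_diff_cancel diff_add_cancel scaleC_add_right)

lemma norm_sq_add:
  "(norm (x + y))\<^sup>2 = (norm x)\<^sup>2 + 2 * Re (cinner x y) + (norm y)\<^sup>2"
proof -
  have "complex_of_real ((norm (x + y))\<^sup>2) =
      cinner x x + cinner x y + cnj (cinner x y) + cinner y y"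
    by (metis (no_types, lifting) cinner_norm cinner_add_left cinner_add_right cinner_commute
        add.assoc)
  then have "Re (complex_of_real ((norm (x + y))\<^sup>2)) =
      Re (cinner x x + cinner x y + cnj (cinner x y) + cinner y y)" by simp
  then show ?thesis by (simp only: cinner_norm) simp
qed

lemma norm_sq_eq_cinner: "(norm x)\<^sup>2 = Re (cinner x x)"
  by (simp add: cinner_norm)

lemma norm_scaleC: "norm (a *\<^sub>C x) = cmod a * norm x"
proof -
  have "(norm (a *\<^sub>C x))\<^sup>2 = Re (a * cnj a * cinner x x)"
    by (simp add: norm_sq_eq_cinner cinner_scaleC_left cinner_scaleC_right mult.assoc mult.left_commute)
  also have "a * cnj a * cinner x x = complex_of_real ((cmod a * norm x)\<^sup>2)"
    by (simp add: cinner_norm complex_norm_square[symmetric] power_mult_distrib)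
  finally show ?thesis by simp
qed

text \<open>The multiple chosen cancels the component of \<open>x\<close> along \<open>y\<close>.
  The resulting drop in norm yields both the Cauchy-Schwarz inequality and the orthogonality of
  minimal vectors.\<close>

lemma norm_add_best_multiple:
  fixes x y :: "'a::chilbert_space"
  assumes "y \<noteq> 0"
  obtains a where "(norm (x + a *\<^sub>C y))\<^sup>2 = (norm x)\<^sup>2 - (cmod (cinner x y) / norm y)\<^sup>2"
proof
  define a where "a = - cinner x y / complex_of_real ((norm y)\<^sup>2)"
  have "cnj a * cinner x y = - complex_of_real ((cmod (cinner x y))\<^sup>2 / (norm y)\<^sup>2)"
    by (simp add: a_def complex_norm_square[symmetric] mult.commute flip: of_real_power)
  then have "Re (cinner x (a *\<^sub>C y)) = - ((cmod (cinner x y))\<^sup>2 / (norm y)\<^sup>2)"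
    by (simp add: cinner_scaleC_right)
  moreover have "norm (a *\<^sub>C y) = cmod (cinner x y) / norm y"
    using assms by (simp add: norm_scaleC a_def norm_divide norm_power power2_eq_square norm_mult
        del: of_real_mult)
  ultimately show "(norm (x + a *\<^sub>C y))\<^sup>2 = (norm x)\<^sup>2 - (cmod (cinner x y) / norm y)\<^sup>2"
    by (simp add: norm_sq_add power_divide)
qed

lemma norm_cinner_le: "cmod (cinner x y) \<le> norm x * norm y"
proof (cases "y = 0")
  case False
  then obtain a where
    "(norm (x + a *\<^sub>C y))\<^sup>2 = (norm x)\<^sup>2 - (cmod (cinner x y) / norm y)\<^sup>2"
    using norm_add_best_multiple by blast
  then have "(cmod (cinner x y) / norm y)\<^sup>2 \<le> (norm x)\<^sup>2"
    by (metis diff_ge_0_iff_ge zero_le_power2)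
  then have "cmod (cinner x y) / norm y \<le> norm x"
    by (simp only: power2_le_imp_le norm_ge_zero)
  then show ?thesis using False by (simp add: pos_divide_le_eq)
qed simp

lemma bounded_bilinear_cinner: "bounded_bilinear cinner"
  by (rule bounded_bilinear.intro)
    (auto simp: cinner_add_left cinner_add_right cinner_scaleR_left cinner_scaleR_right
      scaleR_conv_of_real intro!: exI[of _ 1] norm_cinner_le)

lemmas tendsto_cinner = bounded_bilinear.tendsto[OF bounded_bilinear_cinner]

lemma bounded_linear_scaleC: "bounded_linear (\<lambda>x. a *\<^sub>C x)"
  by (rule bounded_linear_intro[where K = "cmod a"])
    (simp_all add: scaleC_add_right scaleR_scaleC scaleC_scaleC mult.commute norm_scaleC)

lemmas tendsto_scaleC = bounded_linear.tendsto[OF bounded_linear_scaleC]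

lemma parallelogram:
  "(norm (x + y))\<^sup>2 + (norm (x - y))\<^sup>2 = 2 * (norm x)\<^sup>2 + 2 * (norm y)\<^sup>2"
  for x y :: "'a::chilbert_space"
  using norm_sq_add[of x y] norm_sq_add[of x "- y"] by (simp add: cinner_minus_right)

section \<open>Closed subspaces and the projection theorem\<close>

definition csubspace :: "'a::chilbert_space set \<Rightarrow> bool" where
  "csubspace S \<longleftrightarrow> 0 \<in> S \<and> (\<forall>x\<in>S. \<forall>y\<in>S. x + y \<in> S) \<and> (\<forall>a. \<forall>x\<in>S. a *\<^sub>C x \<in> S)"

lemma csubspace_diff: "csubspace S \<Longrightarrow> x \<in> S \<Longrightarrow> y \<in> S \<Longrightarrow> x - y \<in> S"
  unfolding csubspace_def by (metis add_uminus_conv_diff scaleC_minus_one)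

lemma csubspace_scaleR: "csubspace S \<Longrightarrow> x \<in> S \<Longrightarrow> r *\<^sub>R x \<in> S"
  by (simp add: csubspace_def scaleR_scaleC)

lemma csubspace_closure:
  assumes "csubspace S"
  shows "csubspace (closure S)"
  unfolding csubspace_def
proof (intro conjI ballI allI)
  show "0 \<in> closure S"
    using assms closure_subset by (auto simp: csubspace_def)
next
  fix x y assume "x \<in> closure S" "y \<in> closure S"
  then obtain u v where "\<forall>n. u n \<in> S" "u \<longlonglongrightarrow> x" "\<forall>n. v n \<in> S" "v \<longlonglongrightarrow> y"
    by (auto simp: closure_sequential)
  then show "x + y \<in> closure S"
    using assms unfolding closure_sequential csubspace_def
    by (intro exI[of _ "\<lambda>n. u n + v n"]) (auto intro: tendsto_add)
next
  fix a x assume "x \<in> closure S"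
  then obtain u where "\<forall>n. u n \<in> S" "u \<longlonglongrightarrow> x"
    by (auto simp: closure_sequential)
  then show "a *\<^sub>C x \<in> closure S"
    using assms unfolding closure_sequential csubspace_def
    by (intro exI[of _ "\<lambda>n. a *\<^sub>C u n"]) (auto intro: tendsto_scaleC)
qed

text \<open>If the inner product were nonzero, the best multiple of \<open>y\<close> would strictly
  shorten \<open>x\<close>.\<close>

lemma minimal_norm_orthogonal:
  assumes "\<And>a. norm x \<le> norm (x + a *\<^sub>C y)"
  shows "cinner x y = 0"
proof (rule ccontr)
  assume c: "cinner x y \<noteq> 0"
  then have n: "y \<noteq> 0" by auto
  then have p: "(cmod (cinner x y) / norm y)\<^sup>2 > 0" using c by simp
  obtain a where
    "(norm (x + a *\<^sub>C y))\<^sup>2 = (norm x)\<^sup>2 - (cmod (cinner x y) / norm y)\<^sup>2"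
    using norm_add_best_multiple[OF n] by blast
  moreover have "(norm x)\<^sup>2 \<le> (norm (x + a *\<^sub>C y))\<^sup>2"
    by (intro power_mono assms) simp
  ultimately show False using p by argo
qed

text \<open>A minimising sequence is Cauchy by the parallelogram law; its limit is a nearest point,
  and minimality of the distance forces orthogonality.\<close>

theorem projection_exists:
  fixes S :: "'a::chilbert_space set"
  assumes S: "csubspace S" and cl: "closed S"
  shows "\<exists>p\<in>S. \<forall>s\<in>S. cinner (x - p) s = 0"
proof -
  define d where "d = Inf ((\<lambda>s. norm (x - s)) ` S)"
  have bd: "bdd_below ((\<lambda>s. norm (x - s)) ` S)" by (auto intro: bdd_belowI[of _ 0])
  have ne: "S \<noteq> {}" using S by (auto simp: csubspace_def)
  have d_le: "d \<le> norm (x - s)" if "s \<in> S" for s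
    unfolding d_def using bd that by (auto intro: cInf_lower)
  have d0: "0 \<le> d" unfolding d_def using ne by (auto intro: cInf_greatest)
  have "\<exists>s\<in>S. norm (x - s) < d + inverse (Suc n)" for n
  proof -
    have "\<exists>r \<in> (\<lambda>s. norm (x - s)) ` S. r < d + inverse (Suc n)"
      unfolding d_def using ne bd cInf_less_iff[of "(\<lambda>s. norm (x - s)) ` S"]
      by (metis d_def image_is_empty inverse_positive_iff_positive less_add_same_cancel1
          of_nat_0_less_iff zero_less_Suc)
    then show ?thesis by auto
  qed
  then obtain p where p: "\<And>n. p n \<in> S" "\<And>n. norm (x - p n) < d + inverse (Suc n)" by metis
  have lim: "(\<lambda>n. norm (x - p n)) \<longlonglongrightarrow> d"
  proof (rule tendsto_sandwich[OF _ _ tendsto_const])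
    show "(\<lambda>n. d + inverse (real (Suc n))) \<longlonglongrightarrow> d"
      using tendsto_add[OF tendsto_const LIMSEQ_inverse_real_of_nat, of d] by simp
  qed (use p d_le in \<open>auto intro!: always_eventually less_imp_le\<close>)
  have para: "(norm (p m - p n))\<^sup>2 \<le> 2 * ((norm (x - p m))\<^sup>2 - d\<^sup>2) + 2 * ((norm (x - p n))\<^sup>2 - d\<^sup>2)" for m n
  proof -
    \<comment> \<open>The midpoint of \<open>p m\<close> and \<open>p n\<close> lies in
      \<open>S\<close>, so its distance from \<open>x\<close> is at least \<open>d\<close>. This
      bounds the sum in the parallelogram identity from below, hence the difference from
      above.\<close>
    have "(1/2) *\<^sub>R (p m + p n) \<in> S"
      using S p by (intro csubspace_scaleR) (auto simp: csubspace_def)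
    then have "d \<le> norm (x - (1/2) *\<^sub>R (p m + p n))" by (rule d_le)
    also have "x - (1/2) *\<^sub>R (p m + p n) = (1/2) *\<^sub>R ((x - p m) + (x - p n))"
      by (simp add: algebra_simps flip: scaleR_add_left)
    finally have "2 * d \<le> norm ((x - p m) + (x - p n))" by simp
    then have "(2 * d)\<^sup>2 \<le> (norm ((x - p m) + (x - p n)))\<^sup>2"
      using d0 by (intro power_mono) auto
    then show ?thesis
      using parallelogram[of "x - p m" "x - p n"] by (simp add: norm_minus_commute power_mult_distrib)
  qed
  have sq: "(\<lambda>n. (norm (x - p n))\<^sup>2 - d\<^sup>2) \<longlonglongrightarrow> 0"
    using tendsto_diff[OF tendsto_power[OF lim, of 2] tendsto_const, of "d\<^sup>2"] by simp
  have "Cauchy p"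
  proof (rule metric_CauchyI)
    fix e :: real assume e: "0 < e"
    then have "eventually (\<lambda>n. (norm (x - p n))\<^sup>2 - d\<^sup>2 < e\<^sup>2 / 4) sequentially"
      by (intro order_tendstoD(2)[OF sq]) simp
    then obtain N where N: "\<And>n. n \<ge> N \<Longrightarrow> (norm (x - p n))\<^sup>2 - d\<^sup>2 < e\<^sup>2 / 4"
      by (auto simp: eventually_sequentially)
    have "dist (p m) (p n) < e" if "m \<ge> N" "n \<ge> N" for m n
    proof -
      have "(norm (p m - p n))\<^sup>2 < e\<^sup>2"
        by (rule le_less_trans[OF para[of m n]]) (use N[OF that(1)] N[OF that(2)] in argo)
      then show ?thesis using e by (simp add: dist_norm power2_less_imp_less)
    qed
    then show "\<exists>M. \<forall>m\<ge>M. \<forall>n\<ge>M. dist (p m) (p n) < e" by blast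
  qed
  then obtain q where q: "p \<longlonglongrightarrow> q" by (auto simp: Cauchy_convergent_iff convergent_def)
  have qS: "q \<in> S" using cl p(1) q by (auto simp: closed_sequential_limits)
  have "(\<lambda>n. norm (x - p n)) \<longlonglongrightarrow> norm (x - q)"
    by (intro tendsto_norm tendsto_diff tendsto_const q)
  then have dq: "norm (x - q) = d" using lim by (rule LIMSEQ_unique)
  have "cinner (x - q) s = 0" if s: "s \<in> S" for s
  proof (rule minimal_norm_orthogonal)
    fix a
    have "q - a *\<^sub>C s \<in> S" using S s qS by (intro csubspace_diff) (auto simp: csubspace_def)
    then have "d \<le> norm (x - (q - a *\<^sub>C s))" by (rule d_le)
    then show "norm (x - q) \<le> norm (x - q + a *\<^sub>C s)" using dq by (simp add: algebra_simps)
  qed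
  with qS show ?thesis by blast
qed

text \<open>Graphs thereby become subspaces of a Hilbert space, so that the projection theorem
  applies to operators.\<close>

instantiation prod :: (chilbert_space, chilbert_space) chilbert_space
begin

definition scaleC_prod :: "complex \<Rightarrow> 'a \<times> 'b \<Rightarrow> 'a \<times> 'b" where
  "scaleC_prod a x = (a *\<^sub>C fst x, a *\<^sub>C snd x)"

definition cinner_prod :: "'a \<times> 'b \<Rightarrow> 'a \<times> 'b \<Rightarrow> complex" where
  "cinner_prod x y = cinner (fst x) (fst y) + cinner (snd x) (snd y)"

instance
proof
  fix x y z :: "'a \<times> 'b" and a b r
  show "cinner x y = cnj (cinner y x)"
    by (simp add: cinner_prod_def cinner_commute[of "fst x"] cinner_commute[of "snd x"])
  show "cinner x x = complex_of_real ((norm x)\<^sup>2)"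
    by (simp add: cinner_prod_def cinner_norm norm_prod_def)
qed (simp_all add: scaleC_prod_def cinner_prod_def scaleC_add_right scaleC_add_left scaleC_scaleC
    scaleR_scaleC cinner_add_left cinner_scaleC_left scaleR_prod_def algebra_simps)

end

section \<open>The domain of the modulus\<close>

lemma csubspace_linear_op: "linear_op A \<Longrightarrow> csubspace A"
  by (auto simp: csubspace_def linear_op_def scaleC_prod_def zero_prod_def)

lemma csubspace_adj: "csubspace (adj A)"
  unfolding csubspace_def adj_def
  by (fastforce simp: scaleC_prod_def zero_prod_def cinner_add_right cinner_scaleC_right)

lemma csubspace_pair_add:
  "csubspace S \<Longrightarrow> (a, b) \<in> S \<Longrightarrow> (c, d) \<in> S \<Longrightarrow> (a + c, b + d) \<in> S"
  unfolding csubspace_def by (metis add_Pair)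

lemma csubspace_pair_scaleC: "csubspace S \<Longrightarrow> (a, b) \<in> S \<Longrightarrow> (r *\<^sub>C a, r *\<^sub>C b) \<in> S"
  unfolding csubspace_def scaleC_prod_def by force

lemma csubspace_pair_diff:
  "csubspace S \<Longrightarrow> (a, b) \<in> S \<Longrightarrow> (c, d) \<in> S \<Longrightarrow> (a - c, b - d) \<in> S"
  using csubspace_diff by fastforce

lemma csubspace_pair_zero: "csubspace S \<Longrightarrow> (0, 0) \<in> S"
  by (simp add: csubspace_def zero_prod_def)

lemma adjD: "(g, h) \<in> adj A \<Longrightarrow> (f, k) \<in> A \<Longrightarrow> cinner k g = cinner f h"
  by (auto simp: adj_def)

text \<open>Each defining equation is continuous in the pair and passes to limits. A selfadjoint
  operator, being its own adjoint, is therefore closed.\<close>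

lemma closed_adj: "closed (adj A)"
  unfolding closed_sequential_limits
proof (intro allI impI, elim conjE)
  fix x l assume x: "\<forall>n::nat. x n \<in> adj A" and l: "x \<longlonglongrightarrow> l"
  have "cinner k (fst l) = cinner f (snd l)" if "(f, k) \<in> A" for f k
  proof (rule LIMSEQ_unique)
    show "(\<lambda>n. cinner k (fst (x n))) \<longlonglongrightarrow> cinner k (fst l)"
      by (intro tendsto_cinner tendsto_const tendsto_fst l)
    have "cinner k (fst (x n)) = cinner f (snd (x n))" for n
      using adjD[OF _ that, of "fst (x n)" "snd (x n)"] x by simp
    then show "(\<lambda>n. cinner k (fst (x n))) \<longlonglongrightarrow> cinner f (snd l)"
      by (simp only:) (intro tendsto_cinner tendsto_const tendsto_snd l)
  qed
  then show "l \<in> adj A" by (auto simp: adj_def)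
qed

text \<open>The point of \<open>A\<close> closest to \<open>(h, 0)\<close> solves \<open>u + A\<^sup>* A u = h\<close>.\<close>

lemma range_one_plus_adj_comp:
  assumes "csubspace A" "closed A"
  obtains u v where "(u, v) \<in> A" "(v, h - u) \<in> adj A"
proof -
  obtain p where p: "p \<in> A" "\<And>s. s \<in> A \<Longrightarrow> cinner ((h, 0) - p) s = 0"
    using projection_exists[OF assms, of "(h, 0)"] by blast
  \<comment> \<open>Read in components, orthogonality of \<open>(h, 0) - p\<close> to the graph is
    the defining relation of the adjoint.\<close>
  have "cinner k (snd p) = cinner f (h - fst p)" if "(f, k) \<in> A" for f k
  proof -
    have "cinner (snd p) k = cinner (h - fst p) f"
      using p(2)[OF that] by (simp add: cinner_prod_def cinner_minus_left)
    then show ?thesis by (metis cinner_commute)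
  qed
  then have "(snd p, h - fst p) \<in> adj A" by (auto simp: adj_def)
  with p(1) that[of "fst p" "snd p"] show ?thesis by simp
qed

text \<open>The domain of \<open>A\<^sup>* A\<close> is a core for \<open>A\<close>. A point
  \<open>(x, y)\<close> of \<open>A\<close> orthogonal to the restricted graph is tested against
  \<open>(u, v)\<close>, where \<open>u + A\<^sup>* A u = x\<close> and \<open>v = A u\<close>; the
  product collapses to \<open>\<langle>x, x\<rangle>\<close>, so \<open>x = 0\<close> and then
  \<open>y = 0\<close>.\<close>

lemma domain_adj_comp_core:
  assumes lin: "linear_op A" and cl: "closed A"
  shows "A \<subseteq> closure {(u, v) \<in> A. v \<in> Domain (adj A)}"
proof -
  define C where "C = {(u, v) \<in> A. v \<in> Domain (adj A)}"
  note cA = csubspace_linear_op[OF lin]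
  have "csubspace C"
    unfolding csubspace_def
  proof (intro conjI ballI allI)
    show "0 \<in> C"
      using csubspace_pair_zero[OF cA] csubspace_pair_zero[OF csubspace_adj]
      by (auto simp: C_def zero_prod_def)
  next
    fix x y assume "x \<in> C" "y \<in> C"
    then show "x + y \<in> C"
      using csubspace_pair_add[OF cA] csubspace_pair_add[OF csubspace_adj]
      by (fastforce simp: C_def)
  next
    fix a x assume "x \<in> C"
    then show "a *\<^sub>C x \<in> C"
      using csubspace_pair_scaleC[OF cA] csubspace_pair_scaleC[OF csubspace_adj]
      by (fastforce simp: C_def scaleC_prod_def)
  qed
  then have Cs: "csubspace (closure C)" by (rule csubspace_closure)
  have CA: "closure C \<subseteq> A"
    by (rule closure_minimal[OF _ cl]) (auto simp: C_def)
  have "(f, g) \<in> closure C" if x: "(f, g) \<in> A" for f g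
  proof -
    obtain p q where p: "(p, q) \<in> closure C"
        "\<And>s. s \<in> closure C \<Longrightarrow> cinner ((f, g) - (p, q)) s = 0"
      using projection_exists[OF Cs closed_closure, of "(f, g)"]
      by auto
    have d: "(f - p, g - q) \<in> A" using csubspace_pair_diff[OF cA x] p CA by auto
    obtain u v where uv: "(u, v) \<in> A" "(v, (f - p) - u) \<in> adj A"
      using range_one_plus_adj_comp[OF cA cl] by blast
    have "cinner ((f, g) - (p, q)) (u, v) = 0"
      using uv closure_subset[of C] by (intro p(2)) (auto simp: C_def)
    moreover have "cinner (g - q) v = cinner (f - p) ((f - p) - u)"
      using adjD[OF uv(2) d] by simp
    ultimately have "cinner (f - p) (f - p) = 0"
      by (simp add: cinner_prod_def cinner_diff_right)
    then have "f - p = 0" by (simp add: cinner_norm)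
    moreover from this have "g - q = 0"
      using lin d by (auto simp: linear_op_def dest: single_valuedD)
    ultimately show ?thesis using p(1) by simp
  qed
  then show ?thesis unfolding C_def by auto
qed

text \<open>On the common core \<open>D(A\<^sup>* A) = D(B\<^sup>* B)\<close> the squared norms of \<open>A f\<close> and \<open>B f\<close> equal \<open>\<langle>f, A\<^sup>* A f\<rangle>\<close>.\<close>

lemma adj_comp_eq_imp_Domain_subset:
  assumes A: "linear_op A" "closed A" and B: "csubspace B" "closed B"
    and eq: "adj A \<odot> A = adj B \<odot> B"
  shows "Domain A \<subseteq> Domain B"
proof
  fix f assume "f \<in> Domain A"
  then obtain g where fg: "(f, g) \<in> A" by blast
  note cA = csubspace_linear_op[OF A(1)]
  have sq: "cinner v v = cinner u w" if "(u, v) \<in> S" "(v, w) \<in> adj S" for u v w and S :: "'a op_graph"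
    using adjD[OF that(2,1)] by simp
  obtain x where x: "\<And>n. x n \<in> {(u, v) \<in> A. v \<in> Domain (adj A)}" "x \<longlonglongrightarrow> (f, g)"
    using domain_adj_comp_core[OF A] fg by (force simp: closure_sequential)
  define u v where "u n = fst (x n)" and "v n = snd (x n)" for n
  \<comment> \<open>Equality of the two products gives both operators the same \<open>w n\<close>.
    Hence their values at \<open>u m - u n\<close> have equal norms, and \<open>v'\<close> inherits
    the Cauchy property from \<open>v\<close>.\<close>
  have "\<exists>w v'. (v n, w) \<in> adj A \<and> (u n, v') \<in> B \<and> (v', w) \<in> adj B" for n
  proof -
    obtain w where w: "(v n, w) \<in> adj A" using x(1)[of n] by (auto simp: v_def)
    have "(u n, w) \<in> adj A \<odot> A"
      using w x(1)[of n] by (auto simp: op_comp_def u_def v_def)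
    then have "(u n, w) \<in> adj B \<odot> B" by (simp only: eq)
    then show ?thesis using w by (auto simp: op_comp_def)
  qed
  then obtain w v' where w: "\<And>n. (v n, w n) \<in> adj A"
      and v': "\<And>n. (u n, v' n) \<in> B" "\<And>n. (v' n, w n) \<in> adj B" by metis
  have uv: "(u n, v n) \<in> A" for n using x(1)[of n] by (auto simp: u_def v_def)
  have lim: "u \<longlonglongrightarrow> f" "v \<longlonglongrightarrow> g"
    using tendsto_fst[OF x(2)] tendsto_snd[OF x(2)] by (simp_all add: u_def[abs_def] v_def[abs_def])
  have norm_diff: "norm (v' m - v' n) = norm (v m - v n)" for m n
  proof -
    have "cinner (v m - v n) (v m - v n) = cinner (v' m - v' n) (v' m - v' n)"
      using sq[OF csubspace_pair_diff[OF cA uv uv] csubspace_pair_diff[OF csubspace_adj w w]]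
        sq[OF csubspace_pair_diff[OF B(1) v'(1) v'(1)] csubspace_pair_diff[OF csubspace_adj v'(2) v'(2)]]
      by metis
    then show ?thesis by (metis norm_sq_eq_cinner norm_ge_zero power2_eq_imp_eq)
  qed
  have "Cauchy v'"
    using lim(2)[THEN LIMSEQ_imp_Cauchy] by (simp add: Cauchy_def dist_norm norm_diff)
  then obtain g' where g': "v' \<longlonglongrightarrow> g'" by (auto simp: Cauchy_convergent_iff convergent_def)
  have "(f, g') \<in> B"
    by (rule closed_sequentially[OF B(2) _ tendsto_Pair[OF lim(1) g']]) (rule v'(1))
  then show "f \<in> Domain B" by blast
qed

lemma linear_op_closed_positive_selfadjoint:
  assumes "positive_selfadjoint P"
  shows "linear_op P" "closed P"
  using assms closed_adj[of P] by (auto simp: positive_selfadjoint_def)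

text \<open>Selfadjointness of \<open>P\<close> gives \<open>adj P \<odot> P = P \<odot> P\<close>,
  so the inclusion of domains can be applied in both directions.\<close>

lemma is_abs_Domain:
  assumes A: "linear_op A" "closed A" and P: "is_abs A P"
  shows "Domain P = Domain A"
proof -
  have P': "linear_op P" "closed P"
    using P linear_op_closed_positive_selfadjoint by (auto simp: is_abs_def)
  have "adj A \<odot> A = adj P \<odot> P" using P by (auto simp: is_abs_def positive_selfadjoint_def)
  then show ?thesis
    using adj_comp_eq_imp_Domain_subset[OF A csubspace_linear_op[OF P'(1)] P'(2)]
      adj_comp_eq_imp_Domain_subset[OF P' csubspace_linear_op[OF A(1)] A(2)] by simp
qed

section \<open>Spectral measures\<close>

lemma space_borel_Rp: "space borel_Rp = {0..}"
  by (simp add: space_restrict_space)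

lemma borel_Rp_subset: "\<sigma> \<in> sets borel_Rp \<Longrightarrow> \<sigma> \<subseteq> {0..}"
  using sets.sets_into_space[of \<sigma> borel_Rp] by (simp add: space_borel_Rp)

lemma atLeast_0_in_borel_Rp [simp]: "{0..} \<in> sets borel_Rp"
  using sets.top[of borel_Rp] by (simp add: space_borel_Rp)

lemma preim_in_borel_Rp:
  "\<psi> \<in> measurable borel_Rp borel_Rp \<Longrightarrow> \<sigma> \<in> sets borel_Rp \<Longrightarrow> preim \<psi> \<sigma> \<in> sets borel_Rp"
  using measurable_sets[of \<psi> borel_Rp borel_Rp \<sigma>] by (simp add: preim_def space_borel_Rp)

lemma preim_simple:
  assumes "simple_function borel_Rp s"
  shows "finite (s ` {0..})" "preim s A \<in> sets borel_Rp"
  using assms simple_functionD[OF assms] by (auto simp: preim_def space_borel_Rp)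

section \<open>Projection calculus of a spectral measure\<close>

locale spectral =
  fixes E :: "real set \<Rightarrow> 'a::chilbert_space \<Rightarrow> 'a"
  assumes spectral: "spectral_measure E"
begin

lemma orth_proj: "\<sigma> \<in> sets borel_Rp \<Longrightarrow> orth_proj (E \<sigma>)"
  using spectral by (simp add: spectral_measure_def)

lemma clin: "\<sigma> \<in> sets borel_Rp \<Longrightarrow> bounded_clinear (E \<sigma>)"
  using orth_proj by (auto simp: orth_proj_def)

lemma blin: "\<sigma> \<in> sets borel_Rp \<Longrightarrow> bounded_linear (E \<sigma>)"
  using clin by (auto simp: bounded_clinear_def)

lemma lin: "\<sigma> \<in> sets borel_Rp \<Longrightarrow> linear (E \<sigma>)"
  using blin by (auto simp: bounded_linear.linear)

lemma sym: "\<sigma> \<in> sets borel_Rp \<Longrightarrow> cinner (E \<sigma> f) g = cinner f (E \<sigma> g)"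
  using orth_proj by (auto simp: orth_proj_def)

lemma idem: "\<sigma> \<in> sets borel_Rp \<Longrightarrow> E \<sigma> (E \<sigma> f) = E \<sigma> f"
  using orth_proj[of \<sigma>] by (auto simp: orth_proj_def fun_eq_iff)

lemma whole [simp]: "E {0..} f = f"
  using spectral by (simp add: spectral_measure_def)

lemma sums_E:
  "range \<sigma> \<subseteq> sets borel_Rp \<Longrightarrow> disjoint_family \<sigma> \<Longrightarrow> (\<lambda>n::nat. E (\<sigma> n) f) sums E (\<Union>n. \<sigma> n) f"
  using spectral by (simp add: spectral_measure_def)

text \<open>Countable additivity makes a series with constant term \<open>E {} f\<close> converge,
  which forces the term to vanish. Finite additivity then follows by padding with empty
  sets.\<close>

lemma empty [simp]: "E {} f = 0"
proof -
  have "(\<lambda>n::nat. E {} f) sums E (\<Union>n::nat. {}) f"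
    by (rule sums_E) (auto simp: disjoint_family_on_def)
  then show ?thesis by (auto dest: sums_summable simp: summable_const_iff)
qed

lemma union:
  assumes "\<sigma> \<in> sets borel_Rp" "\<tau> \<in> sets borel_Rp" "\<sigma> \<inter> \<tau> = {}"
  shows "E (\<sigma> \<union> \<tau>) f = E \<sigma> f + E \<tau> f"
proof -
  have "(\<lambda>n. E (binaryset \<sigma> \<tau> n) f) sums E (\<Union>n. binaryset \<sigma> \<tau> n) f"
    using assms
    by (intro sums_E) (auto simp: disjoint_family_on_def range_binaryset_eq binaryset_def)
  moreover have "(\<lambda>n. E (binaryset \<sigma> \<tau> n) f) sums (\<Sum>n\<in>{0, 1}. E (binaryset \<sigma> \<tau> n) f)"
    by (rule sums_finite) (auto simp: binaryset_def)
  ultimately have "E (\<Union>n. binaryset \<sigma> \<tau> n) f = (\<Sum>n\<in>{0, 1}. E (binaryset \<sigma> \<tau> n) f)"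
    by (rule sums_unique2)
  then show ?thesis by (simp add: UN_binaryset_eq binaryset_def)
qed

lemma norm_sq: "\<sigma> \<in> sets borel_Rp \<Longrightarrow> (norm (E \<sigma> f))\<^sup>2 = Re (cinner (E \<sigma> f) f)"
  by (metis idem norm_sq_eq_cinner sym)

lemma norm_union:
  assumes "\<sigma> \<in> sets borel_Rp" "\<tau> \<in> sets borel_Rp" "\<sigma> \<inter> \<tau> = {}"
  shows "(norm (E (\<sigma> \<union> \<tau>) f))\<^sup>2 = (norm (E \<sigma> f))\<^sup>2 + (norm (E \<tau> f))\<^sup>2"
proof -
  have "\<sigma> \<union> \<tau> \<in> sets borel_Rp" using assms by auto
  then show ?thesis
    using assms by (simp only: norm_sq) (simp add: union cinner_add_left)
qed

text \<open>For \<open>w = E \<tau> f\<close>, additivity of the squared norms leaves no cross term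
  in the expansion of \<open>norm (E \<sigma> w + E \<tau> w)\<close>. As
  \<open>E \<tau> w = w\<close>, that cross term is the squared norm of
  \<open>E \<sigma> w\<close>.\<close>

lemma disjoint:
  assumes "\<sigma> \<in> sets borel_Rp" "\<tau> \<in> sets borel_Rp" "\<sigma> \<inter> \<tau> = {}"
  shows "E \<sigma> (E \<tau> f) = 0"
proof -
  have "Re (cinner (E \<sigma> (E \<tau> f)) (E \<tau> (E \<tau> f))) = 0"
    using norm_union[OF assms, of "E \<tau> f"] norm_sq_add[of "E \<sigma> (E \<tau> f)" "E \<tau> (E \<tau> f)"]
    by (simp add: union[OF assms])
  then show ?thesis
    using norm_sq[OF assms(1), of "E \<tau> f"] by (simp add: idem assms)
qed

text \<open>Both sets are split into \<open>\<sigma> \<inter> \<tau>\<close> and a difference; every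
  product of disjoint pieces vanishes.\<close>

lemma mult:
  assumes s: "\<sigma> \<in> sets borel_Rp" and t: "\<tau> \<in> sets borel_Rp"
  shows "E \<sigma> (E \<tau> f) = E (\<sigma> \<inter> \<tau>) f"
proof -
  have *: "\<sigma> \<inter> \<tau> \<in> sets borel_Rp" "\<sigma> - \<tau> \<in> sets borel_Rp" "\<tau> - \<sigma> \<in> sets borel_Rp"
    using s t by auto
  have "\<sigma> \<inter> \<tau> \<union> (\<tau> - \<sigma>) = \<tau>" "\<sigma> \<inter> \<tau> \<union> (\<sigma> - \<tau>) = \<sigma>" by blast+
  then have "E \<tau> f = E (\<sigma> \<inter> \<tau>) f + E (\<tau> - \<sigma>) f"
      and "E \<sigma> g = E (\<sigma> \<inter> \<tau>) g + E (\<sigma> - \<tau>) g" for g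
    using union[of "\<sigma> \<inter> \<tau>" "\<tau> - \<sigma>" f] union[of "\<sigma> \<inter> \<tau>" "\<sigma> - \<tau>" g] *
    by (metis Diff_disjoint Int_Diff inf_commute inf_left_commute inf_bot_right)+
  moreover have "E (\<sigma> \<inter> \<tau>) (E (\<tau> - \<sigma>) f) = 0" "E (\<sigma> - \<tau>) (E (\<sigma> \<inter> \<tau>) f) = 0"
      "E (\<sigma> - \<tau>) (E (\<tau> - \<sigma>) f) = 0"
    using * by (auto intro!: disjoint)
  ultimately show ?thesis
    by (simp add: linear_add[OF lin] * idem)
qed

lemma compl:
  assumes "\<sigma> \<in> sets borel_Rp"
  shows "E ({0..} - \<sigma>) f = f - E \<sigma> f"
    and "(norm f)\<^sup>2 = (norm (E \<sigma> f))\<^sup>2 + (norm (E ({0..} - \<sigma>) f))\<^sup>2"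
proof -
  have *: "{0..} - \<sigma> \<in> sets borel_Rp" "\<sigma> \<inter> ({0..} - \<sigma>) = {}" "\<sigma> \<union> ({0..} - \<sigma>) = {0..}"
    using assms borel_Rp_subset[OF assms] by auto
  show "E ({0..} - \<sigma>) f = f - E \<sigma> f"
    using union[OF assms *(1,2), of f] unfolding *(3) whole by (metis add_diff_cancel_left')
  show "(norm f)\<^sup>2 = (norm (E \<sigma> f))\<^sup>2 + (norm (E ({0..} - \<sigma>) f))\<^sup>2"
    using norm_union[OF assms *(1,2), of f] by (simp only: *(3) whole)
qed

lemma norm_le: "\<sigma> \<in> sets borel_Rp \<Longrightarrow> norm (E \<sigma> f) \<le> norm f"
  by (rule power2_le_imp_le) (simp_all only: compl(2)[of \<sigma> f] norm_ge_zero, simp)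

text \<open>Disjointing the sequence turns \<open>E (S n) f\<close> into the partial sums of a
  series covered by countable additivity.\<close>

lemma incseq_limit:
  assumes S: "range S \<subseteq> sets borel_Rp" "incseq S"
  shows "(\<lambda>n. E (S n) f) \<longlonglongrightarrow> E (\<Union>n. S n) f"
proof -
  have d: "range (disjointed S) \<subseteq> sets borel_Rp" by (rule sets.range_disjointed_sets[OF S(1)])
  have "(\<Sum>i\<le>n. E (disjointed S i) f) = E (\<Union>i\<le>n. disjointed S i) f" for n
  proof (induction n)
    case (Suc n)
    have "disjointed S i \<inter> disjointed S (Suc n) = {}" if "i \<le> n" for i
      by (rule disjoint_family_onD[OF disjoint_family_disjointed]) (use that in auto)
    then have "(\<Union>i\<le>n. disjointed S i) \<inter> disjointed S (Suc n) = {}" by blast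
    moreover have "(\<Union>i\<le>n. disjointed S i) \<in> sets borel_Rp" using d by (intro sets.finite_UN) auto
    ultimately have "E ((\<Union>i\<le>n. disjointed S i) \<union> disjointed S (Suc n)) f =
        E (\<Union>i\<le>n. disjointed S i) f + E (disjointed S (Suc n)) f"
      using d by (intro union) auto
    then show ?case by (simp add: Suc atMost_Suc Un_commute)
  qed simp
  moreover have "(\<Union>i\<le>n. disjointed S i) = S n" for n
  proof -
    have "(\<Union>i\<le>n. disjointed S i) = (\<Union>i\<le>n. S i)"
      using finite_UN_disjointed_eq[of S "Suc n"]
      by (simp only: atLeast0LessThan lessThan_Suc_atMost)
    also have "\<dots> = S n" using S(2) unfolding incseq_def by blast
    finally show ?thesis .
  qed
  ultimately have "(\<Sum>i\<le>n. E (disjointed S i) f) = E (S n) f" for n by simp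
  then show ?thesis
    using sums_E[OF d disjoint_family_disjointed, of f] by (simp add: sums_def_le UN_disjointed_eq)
qed

section \<open>The scalar measures of a spectral measure\<close>

lemma space_scalar [simp]: "space (scalar_measure E f) = {0..}"
  unfolding scalar_measure_def
  by (rule space_measure_of) (auto dest: borel_Rp_subset)

lemma sets_scalar [measurable_cong, simp]: "sets (scalar_measure E f) = sets borel_Rp"
  unfolding scalar_measure_def
  using sets.sigma_sets_eq[of borel_Rp] borel_Rp_subset
  by (subst sets_measure_of) (auto simp: space_borel_Rp)

text \<open>\<open>measure_of\<close> returns the prescribed values only after positivity and
  countable additivity are verified. The latter is strong additivity of \<open>E\<close> under a
  continuous functional.\<close>

lemma emeasure_scalar:
  assumes "\<sigma> \<in> sets borel_Rp"
  shows "emeasure (scalar_measure E f) \<sigma> = ennreal ((norm (E \<sigma> f))\<^sup>2)"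
proof -
  have "emeasure (scalar_measure E f) \<sigma> = ennreal (Re (cinner (E \<sigma> f) f))"
  proof (rule emeasure_measure_of[OF scalar_measure_def])
    show "sets borel_Rp \<subseteq> Pow {0..}" using borel_Rp_subset by auto
    show "\<sigma> \<in> sets (scalar_measure E f)" using assms by simp
    show "positive (sets (scalar_measure E f)) (\<lambda>\<sigma>. ennreal (Re (cinner (E \<sigma> f) f)))"
      by (simp add: positive_def)
    show "countably_additive (sets (scalar_measure E f)) (\<lambda>\<sigma>. ennreal (Re (cinner (E \<sigma> f) f)))"
    proof (rule countably_additiveI)
      fix S :: "nat \<Rightarrow> real set"
      assume S: "range S \<subseteq> sets (scalar_measure E f)" "disjoint_family S"
      have "bounded_linear (\<lambda>x. Re (cinner x f))"
        using bounded_bilinear.bounded_linear_left[OF bounded_bilinear_cinner]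
          bounded_linear_compose[OF bounded_linear_Re] by blast
      then have "(\<lambda>n. Re (cinner (E (S n) f) f)) sums Re (cinner (E (\<Union>n. S n) f) f)"
        using S by (intro bounded_linear.sums[OF _ sums_E]) auto
      moreover have "0 \<le> Re (cinner (E (S n) f) f)" for n
        using S(1) norm_sq[of "S n" f, symmetric] by auto
      ultimately show "(\<Sum>n. ennreal (Re (cinner (E (S n) f) f))) =
          ennreal (Re (cinner (E (\<Union>n. S n) f) f))"
        by (intro suminf_ennreal_eq)
    qed
  qed
  then show ?thesis by (simp add: norm_sq assms)
qed

section \<open>Integrals of simple functions\<close>

lemma E_simple_const:
  assumes s: "simple_function borel_Rp s" and S: "S \<in> sets borel_Rp"
    and c: "\<And>x. x \<in> S \<Longrightarrow> s x = c"
  shows "E S (simple_spectral_integral E s f) = c *\<^sub>R E S f"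
proof (cases "S = {}")
  case False
  have "E S (simple_spectral_integral E s f) = (\<Sum>y\<in>s ` {0..}. y *\<^sub>R E S (E (preim s {y}) f))"
    by (simp add: simple_spectral_integral_def linear_sum[OF lin[OF S]] linear_scale[OF lin[OF S]])
  also have "\<dots> = (\<Sum>y\<in>s ` {0..}. if y = c then c *\<^sub>R E S f else 0)"
  proof (rule sum.cong[OF refl])
    fix y
    have "S \<inter> preim s {y} = (if y = c then S else {})"
      using c borel_Rp_subset[OF S] by (auto simp: preim_def)
    then show "y *\<^sub>R E S (E (preim s {y}) f) = (if y = c then c *\<^sub>R E S f else 0)"
      by (simp add: mult[OF S preim_simple(2)[OF s]])
  qed
  also have "\<dots> = c *\<^sub>R E S f"
    using False c borel_Rp_subset[OF S] preim_simple(1)[OF s] by (force simp: sum.delta)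
  finally show ?thesis .
qed simp

lemma E_simple_commute:
  assumes s: "simple_function borel_Rp s" and S: "S \<in> sets borel_Rp"
  shows "E S (simple_spectral_integral E s f) = simple_spectral_integral E s (E S f)"
  by (simp add: simple_spectral_integral_def linear_sum[OF lin[OF S]] linear_scale[OF lin[OF S]]
      mult[OF S preim_simple(2)[OF s]] mult[OF preim_simple(2)[OF s] S] Int_commute)

lemma simple_const: "simple_spectral_integral E (\<lambda>_. t) f = t *\<^sub>R f"
  by (auto simp: simple_spectral_integral_def preim_def image_constant_conv)

text \<open>This is the isometry of the spectral integral, localised to \<open>S\<close>. The common
  level sets \<open>P k\<close> of \<open>s\<close> and \<open>s'\<close> partition
  \<open>S\<close>, and on each of them the difference of the integrals is a scalar multiple of
  \<open>f\<close>.\<close>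

lemma norm_simple_diff:
  assumes s: "simple_function borel_Rp s" and s': "simple_function borel_Rp s'"
    and S: "S \<in> sets borel_Rp"
  shows "ennreal ((norm (E S (simple_spectral_integral E s f - simple_spectral_integral E s' f)))\<^sup>2)
    = (\<integral>\<^sup>+x\<in>S. ennreal ((s x - s' x)\<^sup>2) \<partial>scalar_measure E f)"
proof -
  define h where "h = simple_spectral_integral E s f - simple_spectral_integral E s' f"
  define K where "K = s ` {0..} \<times> s' ` {0..}"
  define P where "P k = S \<inter> preim s {fst k} \<inter> preim s' {snd k}" for k
  have fin: "finite K" using preim_simple(1)[OF s] preim_simple(1)[OF s'] by (simp add: K_def)
  have P: "P k \<in> sets borel_Rp" for k
    using S preim_simple(2)[OF s] preim_simple(2)[OF s'] by (auto simp: P_def)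
  have dis: "disjoint_family_on P K"
    by (auto simp: disjoint_family_on_def P_def preim_def)
  have un: "(\<Union>k\<in>K. P k) = S"
    using borel_Rp_subset[OF S] by (auto simp: P_def preim_def K_def)
  have EP: "E (P k) h = (fst k - snd k) *\<^sub>R E (P k) f" for k
  proof -
    have "E (P k) h = fst k *\<^sub>R E (P k) f - snd k *\<^sub>R E (P k) f"
      unfolding h_def linear_diff[OF lin[OF P]]
      by (intro arg_cong2[where f = "(-)"] E_simple_const s s' P) (auto simp: P_def preim_def)
    then show ?thesis by (simp add: scaleR_diff_left)
  qed
  have "ennreal ((norm (E S h))\<^sup>2) = emeasure (scalar_measure E h) (\<Union>k\<in>K. P k)"
    by (simp add: emeasure_scalar S un)
  also have "\<dots> = (\<Sum>k\<in>K. emeasure (scalar_measure E h) (P k))"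
    using P fin dis by (intro sum_emeasure[symmetric]) auto
  also have "\<dots> = (\<Sum>k\<in>K. ennreal ((fst k - snd k)\<^sup>2) * emeasure (scalar_measure E f) (P k))"
    by (simp add: emeasure_scalar P EP power_mult_distrib ennreal_mult)
  also have "\<dots> = (\<Sum>k\<in>K. \<integral>\<^sup>+x. ennreal ((fst k - snd k)\<^sup>2) * indicator (P k) x \<partial>scalar_measure E f)"
    using P by (simp add: nn_integral_cmult_indicator)
  also have "\<dots> = (\<integral>\<^sup>+x. (\<Sum>k\<in>K. ennreal ((fst k - snd k)\<^sup>2) * indicator (P k) x) \<partial>scalar_measure E f)"
    using P by (intro nn_integral_sum[symmetric]) simp
  also have "\<dots> = (\<integral>\<^sup>+x\<in>S. ennreal ((s x - s' x)\<^sup>2) \<partial>scalar_measure E f)"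
  proof (rule nn_integral_cong)
    fix x assume x: "x \<in> space (scalar_measure E f)"
    have "(\<Sum>k\<in>K. ennreal ((fst k - snd k)\<^sup>2) * indicator (P k) x) =
      (\<Sum>k\<in>K. if k = (s x, s' x) then ennreal ((s x - s' x)\<^sup>2) * indicator S x else 0)"
      using x by (intro sum.cong) (auto simp: P_def preim_def indicator_def)
    then show "(\<Sum>k\<in>K. ennreal ((fst k - snd k)\<^sup>2) * indicator (P k) x) =
        ennreal ((s x - s' x)\<^sup>2) * indicator S x"
      using x fin by (simp add: K_def)
  qed
  finally show ?thesis by (simp add: h_def)
qed

end

section \<open>Spectral integrals as limits of dyadic sums\<close>

text \<open>One explicit sequence of simple functions serves all spectral measures at once, so that
  an intertwiner can be moved through the sums. The cap at \<open>real n\<close> keeps the range on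
  the half-line finite.\<close>

definition dyadic :: "nat \<Rightarrow> real \<Rightarrow> real" where
  "dyadic n x = min (real n) (of_int \<lfloor>2 ^ n * x\<rfloor> / 2 ^ n)"

lemma dyadic_nonneg: "0 \<le> x \<Longrightarrow> 0 \<le> dyadic n x"
  by (simp add: dyadic_def)

lemma dyadic_le: "dyadic n x \<le> x"
proof -
  have "of_int \<lfloor>2 ^ n * x\<rfloor> / 2 ^ n \<le> x"
    by (simp add: divide_le_eq mult.commute)
  then show ?thesis by (auto simp: dyadic_def)
qed

lemma dyadic_ge: "min (real n) (x - 1 / 2 ^ n) \<le> dyadic n x"
proof -
  have "2 ^ n * x - 1 \<le> of_int \<lfloor>2 ^ n * x\<rfloor>" by linarith
  then have "(2 ^ n * x - 1) / 2 ^ n \<le> of_int \<lfloor>2 ^ n * x\<rfloor> / 2 ^ n"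
    by (rule divide_right_mono) simp
  then have "x - 1 / 2 ^ n \<le> of_int \<lfloor>2 ^ n * x\<rfloor> / 2 ^ n"
    by (simp add: diff_divide_distrib)
  then show ?thesis by (auto simp: dyadic_def)
qed

lemma dyadic_tendsto: "(\<lambda>n. dyadic n x) \<longlonglongrightarrow> x"
proof (rule tendsto_sandwich[OF _ _ _ tendsto_const])
  show "(\<lambda>n. x - 1 / 2 ^ n) \<longlonglongrightarrow> x"
    using tendsto_diff[OF tendsto_const LIMSEQ_inverse_realpow_zero[of 2], of x]
    by (simp add: inverse_eq_divide)
  obtain N where N: "x \<le> real N" using real_arch_simple by blast
  then have "x - 1 / 2 ^ n \<le> dyadic n x" if "n \<ge> N" for n
  proof -
    have "x - 1 / 2 ^ n \<le> x" by simp
    also have "x \<le> real n" using N that by simp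
    finally show ?thesis using dyadic_ge[of n x] by (simp add: min_absorb2)
  qed
  then show "\<forall>\<^sub>F n in sequentially. x - 1 / 2 ^ n \<le> dyadic n x"
    by (auto simp: eventually_sequentially)
qed (simp add: dyadic_le)

lemma simple_function_dyadic: "simple_function borel_Rp (dyadic n)"
proof -
  have "dyadic n ` {0..} \<subseteq> (\<lambda>k. of_int k / 2 ^ n) ` {0..int n * 2 ^ n}"
  proof
    fix y assume "y \<in> dyadic n ` {0..}"
    then obtain x where x: "0 \<le> x" "y = dyadic n x" by auto
    define k where "k = min (int n * 2 ^ n) \<lfloor>2 ^ n * x\<rfloor>"
    have "y = of_int k / 2 ^ n"
      by (simp add: x(2) dyadic_def k_def of_int_min min_divide_distrib_right)
    moreover have "k \<in> {0..int n * 2 ^ n}" using x(1) by (simp add: k_def)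
    ultimately show "y \<in> (\<lambda>k. of_int k / 2 ^ n) ` {0..int n * 2 ^ n}" by blast
  qed
  then have "finite (dyadic n ` {0..})" by (rule finite_subset) simp
  moreover have "dyadic n \<in> borel_measurable borel_Rp"
    by (rule measurable_restrict_space1) (unfold dyadic_def, measurable)
  ultimately show ?thesis
    by (auto simp: simple_function_borel_measurable space_borel_Rp)
qed

lemma simple_function_dyadic_comp:
  assumes "\<psi> \<in> measurable borel_Rp borel_Rp"
  shows "simple_function borel_Rp (\<lambda>x. dyadic n (\<psi> x))"
  using simple_function_comp[OF assms simple_function_dyadic, of n] by (simp add: comp_def)

text \<open>The two sides differ by the square of \<open>(a - b) + (a - c)\<close>. It compares two
  approximants through their common target \<open>a\<close>.\<close>

lemma square_diff_le: "(b - c)\<^sup>2 \<le> 2 * (a - b)\<^sup>2 + 2 * (a - c)\<^sup>2" for a b c :: real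
  using zero_le_power2[of "(a - b) + (a - c)"] by (simp add: power2_eq_square algebra_simps)

lemma ennreal_two_plus:
  "0 \<le> a \<Longrightarrow> 0 \<le> b \<Longrightarrow> ennreal (2 * a + 2 * b) = 2 * ennreal a + 2 * ennreal b"
  by (simp add: ennreal_mult)

section \<open>Image measures and convergence of dyadic sums\<close>

context spectral
begin

lemma simple_spectral_integral_comp:
  assumes \<psi>: "\<psi> \<in> measurable borel_Rp borel_Rp" and s: "simple_function borel_Rp s"
  shows "simple_spectral_integral E (\<lambda>x. s (\<psi> x)) = simple_spectral_integral (\<lambda>\<sigma>. E (preim \<psi> \<sigma>)) s"
proof
  fix f
  have range: "\<psi> ` {0..} \<subseteq> {0..}"
    using measurable_space[OF \<psi>] by (auto simp: space_borel_Rp)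
  have pre: "preim (\<lambda>x. s (\<psi> x)) A = preim \<psi> (preim s A)" for A
    using range by (auto simp: preim_def)
  \<comment> \<open>Values of \<open>s\<close> that are missed on the range of \<open>\<psi>\<close>
    have empty preimage and contribute zero.\<close>
  have "(\<Sum>y\<in>(\<lambda>x. s (\<psi> x)) ` {0..}. y *\<^sub>R E (preim \<psi> (preim s {y})) f) =
    (\<Sum>y\<in>s ` {0..}. y *\<^sub>R E (preim \<psi> (preim s {y})) f)"
  proof (rule sum.mono_neutral_left)
    show "\<forall>y\<in>s ` {0..} - (\<lambda>x. s (\<psi> x)) ` {0..}. y *\<^sub>R E (preim \<psi> (preim s {y})) f = 0"
    proof
      fix y assume "y \<in> s ` {0..} - (\<lambda>x. s (\<psi> x)) ` {0..}"
      then have "preim \<psi> (preim s {y}) = {}" by (force simp: preim_def image_iff)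
      then show "y *\<^sub>R E (preim \<psi> (preim s {y})) f = 0" by simp
    qed
  qed (use range preim_simple(1)[OF s] in auto)
  then show "simple_spectral_integral E (\<lambda>x. s (\<psi> x)) f =
      simple_spectral_integral (\<lambda>\<sigma>. E (preim \<psi> \<sigma>)) s f"
    by (simp add: simple_spectral_integral_def pre)
qed

lemma spectral_measure_preim:
  assumes \<psi>: "\<psi> \<in> measurable borel_Rp borel_Rp"
  shows "spectral_measure (\<lambda>\<sigma>. E (preim \<psi> \<sigma>))"
  unfolding spectral_measure_def
proof (intro conjI ballI allI impI)
  show "E (preim \<psi> {0..}) = id"
  proof -
    have "preim \<psi> {0..} = {0..}"
      using measurable_space[OF \<psi>] by (auto simp: space_borel_Rp preim_def)
    then show ?thesis by (simp add: fun_eq_iff)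
  qed
next
  fix \<sigma> :: "nat \<Rightarrow> real set" and f
  assume "range \<sigma> \<subseteq> sets borel_Rp" "disjoint_family \<sigma>"
  then have "(\<lambda>n. E (preim \<psi> (\<sigma> n)) f) sums E (\<Union>n. preim \<psi> (\<sigma> n)) f"
    by (intro sums_E) (auto intro!: preim_in_borel_Rp[OF \<psi>], auto simp: disjoint_family_on_def preim_def)
  moreover have "(\<Union>n. preim \<psi> (\<sigma> n)) = preim \<psi> (\<Union>n. \<sigma> n)" by (auto simp: preim_def)
  ultimately show "(\<lambda>n. E (preim \<psi> (\<sigma> n)) f) sums E (preim \<psi> (\<Union>n. \<sigma> n)) f" by simp
qed (simp add: orth_proj preim_in_borel_Rp[OF \<psi>])

text \<open>Dominated convergence applies with dominating function \<open>\<psi>\<^sup>2\<close>,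
  because \<open>dyadic n (\<psi> x)\<close> lies between \<open>0\<close> and
  \<open>\<psi> x\<close>.\<close>

lemma dyadic_L2_tendsto:
  assumes \<psi>: "\<psi> \<in> measurable borel_Rp borel_Rp"
    and fin: "(\<integral>\<^sup>+x. ennreal ((\<psi> x)\<^sup>2) \<partial>scalar_measure E f) < \<infinity>"
  shows "(\<lambda>n. \<integral>\<^sup>+x. ennreal ((\<psi> x - dyadic n (\<psi> x))\<^sup>2) \<partial>scalar_measure E f) \<longlonglongrightarrow> 0"
proof -
  have \<psi>b [measurable]: "\<psi> \<in> borel_measurable (scalar_measure E f)"
    using \<psi> by (simp add: measurable_restrict_space2_iff cong: measurable_cong_sets)
  have nn: "0 \<le> \<psi> x" if "0 \<le> x" for x
    using measurable_space[OF \<psi>, of x] that by (simp add: space_borel_Rp)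
  have [measurable]: "dyadic n \<in> borel_measurable borel" for n
    unfolding dyadic_def by measurable
  have "(\<lambda>n. \<integral>\<^sup>+x. ennreal ((\<psi> x - dyadic n (\<psi> x))\<^sup>2) \<partial>scalar_measure E f) \<longlonglongrightarrow>
      (\<integral>\<^sup>+x. 0 \<partial>scalar_measure E f)"
  proof (rule nn_integral_dominated_convergence[where w = "\<lambda>x. ennreal ((\<psi> x)\<^sup>2)"])
    show "AE x in scalar_measure E f.
        (\<lambda>n. ennreal ((\<psi> x - dyadic n (\<psi> x))\<^sup>2)) \<longlonglongrightarrow> 0"
    proof (rule AE_I2)
      fix x
      have "(\<lambda>n. (\<psi> x - dyadic n (\<psi> x))\<^sup>2) \<longlonglongrightarrow> (\<psi> x - \<psi> x)\<^sup>2"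
        by (intro tendsto_intros dyadic_tendsto)
      from tendsto_ennrealI[OF this]
      show "(\<lambda>n. ennreal ((\<psi> x - dyadic n (\<psi> x))\<^sup>2)) \<longlonglongrightarrow> 0" by simp
    qed
    show "AE x in scalar_measure E f. ennreal ((\<psi> x - dyadic n (\<psi> x))\<^sup>2) \<le> ennreal ((\<psi> x)\<^sup>2)" for n
      using dyadic_nonneg nn dyadic_le
      by (intro AE_I2 ennreal_leI power_mono) auto
  qed (use fin in auto)
  then show ?thesis by simp
qed

lemma norm_simple_sq:
  assumes s: "simple_function borel_Rp s"
  shows "ennreal ((norm (simple_spectral_integral E s f))\<^sup>2) =
    (\<integral>\<^sup>+x. ennreal ((s x)\<^sup>2) \<partial>scalar_measure E f)"
proof -
  have "simple_function borel_Rp (\<lambda>_. 0::real)" by simp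
  from norm_simple_diff[OF s this, of "{0..}" f]
  show ?thesis
    by (simp add: simple_const) (rule nn_integral_cong, simp)
qed

text \<open>Any admissible sequence of simple functions may be replaced by the dyadic approximations
  of \<open>\<psi>\<close>. Conversely, convergence of the dyadic sums bounds
  \<open>\<integral> (dyadic n \<circ> \<psi>)\<^sup>2\<close>, and Fatou's lemma puts \<open>f\<close> into the domain.\<close>

theorem spectral_integral_iff:
  assumes \<psi>: "\<psi> \<in> measurable borel_Rp borel_Rp"
  shows "(f, g) \<in> spectral_integral E \<psi> \<longleftrightarrow>
    (\<lambda>n. simple_spectral_integral E (\<lambda>x. dyadic n (\<psi> x)) f) \<longlonglongrightarrow> g"
proof
  note sd = simple_function_dyadic_comp[OF \<psi>]
  have \<psi>b [measurable]: "\<psi> \<in> borel_measurable (scalar_measure E f)"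
    using \<psi> by (simp add: measurable_restrict_space2_iff cong: measurable_cong_sets)
  have [measurable]: "dyadic n \<in> borel_measurable borel" for n
    unfolding dyadic_def by measurable
  let ?D = "\<lambda>n. simple_spectral_integral E (\<lambda>x. dyadic n (\<psi> x)) f"
  {
    assume "(f, g) \<in> spectral_integral E \<psi>"
    then obtain s where fin: "(\<integral>\<^sup>+x. ennreal ((\<psi> x)\<^sup>2) \<partial>scalar_measure E f) < \<infinity>"
      and s: "\<And>n. simple_function borel_Rp (s n)"
      and L2: "(\<lambda>n. \<integral>\<^sup>+x. ennreal ((\<psi> x - s n x)\<^sup>2) \<partial>scalar_measure E f) \<longlonglongrightarrow> 0"
      and g: "(\<lambda>n. simple_spectral_integral E (s n) f) \<longlonglongrightarrow> g"
      by (auto simp: spectral_integral_def)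
    have sb [measurable]: "s n \<in> borel_measurable (scalar_measure E f)" for n
      using borel_measurable_simple_function[OF s[of n]] by (simp cong: measurable_cong_sets)
    let ?d = "\<lambda>n. ?D n - simple_spectral_integral E (s n) f"
    \<comment> \<open>The isometry turns the norm into an integral, in which both approximants are
      compared with \<open>\<psi>\<close>; each of the two resulting integrals tends to
      zero.\<close>
    have le: "ennreal ((norm (?d n))\<^sup>2) \<le>
      2 * (\<integral>\<^sup>+x. ennreal ((\<psi> x - dyadic n (\<psi> x))\<^sup>2) \<partial>scalar_measure E f) +
      2 * (\<integral>\<^sup>+x. ennreal ((\<psi> x - s n x)\<^sup>2) \<partial>scalar_measure E f)" for n
    proof -
      have "ennreal ((norm (?d n))\<^sup>2) =
        (\<integral>\<^sup>+x\<in>{0..}. ennreal ((dyadic n (\<psi> x) - s n x)\<^sup>2) \<partial>scalar_measure E f)"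
        using norm_simple_diff[OF sd s, of "{0..}" n f n] by simp
      also have "\<dots> \<le> (\<integral>\<^sup>+x. 2 * ennreal ((\<psi> x - dyadic n (\<psi> x))\<^sup>2) +
          2 * ennreal ((\<psi> x - s n x)\<^sup>2) \<partial>scalar_measure E f)"
      proof (rule nn_integral_mono)
        fix x
        have "(dyadic n (\<psi> x) - s n x)\<^sup>2 \<le>
            2 * (\<psi> x - dyadic n (\<psi> x))\<^sup>2 + 2 * (\<psi> x - s n x)\<^sup>2"
          by (rule square_diff_le)
        then have "ennreal ((dyadic n (\<psi> x) - s n x)\<^sup>2) \<le>
            2 * ennreal ((\<psi> x - dyadic n (\<psi> x))\<^sup>2) + 2 * ennreal ((\<psi> x - s n x)\<^sup>2)"
          using ennreal_leI ennreal_two_plus[OF zero_le_power2 zero_le_power2] by metis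
        then show "ennreal ((dyadic n (\<psi> x) - s n x)\<^sup>2) * indicator {0..} x \<le>
            2 * ennreal ((\<psi> x - dyadic n (\<psi> x))\<^sup>2) + 2 * ennreal ((\<psi> x - s n x)\<^sup>2)"
          by (auto simp: indicator_def)
      qed
      also have "\<dots> = 2 * (\<integral>\<^sup>+x. ennreal ((\<psi> x - dyadic n (\<psi> x))\<^sup>2) \<partial>scalar_measure E f) +
          2 * (\<integral>\<^sup>+x. ennreal ((\<psi> x - s n x)\<^sup>2) \<partial>scalar_measure E f)"
        by (subst nn_integral_add) (auto simp: nn_integral_cmult)
      finally show ?thesis .
    qed
    have "(\<lambda>n. 2 * (\<integral>\<^sup>+x. ennreal ((\<psi> x - dyadic n (\<psi> x))\<^sup>2) \<partial>scalar_measure E f) +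
      2 * (\<integral>\<^sup>+x. ennreal ((\<psi> x - s n x)\<^sup>2) \<partial>scalar_measure E f)) \<longlonglongrightarrow> 2 * 0 + 2 * 0"
      by (intro tendsto_add ennreal_tendsto_cmult L2 dyadic_L2_tendsto \<psi> fin) auto
    then have "(\<lambda>n. ennreal ((norm (?d n))\<^sup>2)) \<longlonglongrightarrow> ennreal 0"
      by (intro tendsto_sandwich[OF _ always_eventually[OF allI[OF le]] tendsto_const])
        (simp_all only: ennreal_0 zero_le always_eventually mult_zero_right add_0_right simp_thms)
    then have "(\<lambda>n. (norm (?d n))\<^sup>2) \<longlonglongrightarrow> 0"
      by (subst (asm) tendsto_ennreal_iff) auto
    then have "?d \<longlonglongrightarrow> 0"
      using tendsto_real_sqrt[of "\<lambda>n. (norm (?d n))\<^sup>2" 0] by (auto intro: tendsto_norm_zero_cancel)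
    from tendsto_add[OF this g] show "?D \<longlonglongrightarrow> g" by simp
  }
  assume g: "?D \<longlonglongrightarrow> g"
  have "(\<integral>\<^sup>+x. ennreal ((\<psi> x)\<^sup>2) \<partial>scalar_measure E f) =
      (\<integral>\<^sup>+x. liminf (\<lambda>n. ennreal ((dyadic n (\<psi> x))\<^sup>2)) \<partial>scalar_measure E f)"
  proof (rule nn_integral_cong)
    fix x
    have "(\<lambda>n. ennreal ((dyadic n (\<psi> x))\<^sup>2)) \<longlonglongrightarrow> ennreal ((\<psi> x)\<^sup>2)"
      by (intro tendsto_ennrealI tendsto_power dyadic_tendsto)
    then show "ennreal ((\<psi> x)\<^sup>2) = liminf (\<lambda>n. ennreal ((dyadic n (\<psi> x))\<^sup>2))"
      by (intro lim_imp_Liminf[symmetric]) auto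
  qed
  also have "\<dots> \<le> liminf (\<lambda>n. \<integral>\<^sup>+x. ennreal ((dyadic n (\<psi> x))\<^sup>2) \<partial>scalar_measure E f)"
    by (rule nn_integral_liminf) measurable
  also have "\<dots> = liminf (\<lambda>n. ennreal ((norm (?D n))\<^sup>2))"
    by (simp add: norm_simple_sq[OF sd])
  also have "\<dots> = ennreal ((norm g)\<^sup>2)"
    by (intro lim_imp_Liminf tendsto_ennrealI tendsto_power tendsto_norm g) simp
  finally have fin: "(\<integral>\<^sup>+x. ennreal ((\<psi> x)\<^sup>2) \<partial>scalar_measure E f) < \<infinity>"
    by (rule le_less_trans) simp
  then show "(f, g) \<in> spectral_integral E \<psi>"
    unfolding spectral_integral_def using sd dyadic_L2_tendsto[OF \<psi> fin] g
    by (auto intro!: exI[of _ "\<lambda>n x. dyadic n (\<psi> x)"])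
qed

corollary spectral_integral_iff_preim:
  assumes \<psi>: "\<psi> \<in> measurable borel_Rp borel_Rp"
  shows "(f, g) \<in> spectral_integral E \<psi> \<longleftrightarrow>
    (\<lambda>n. simple_spectral_integral (\<lambda>\<sigma>. E (preim \<psi> \<sigma>)) (dyadic n) f) \<longlonglongrightarrow> g"
  by (simp add: spectral_integral_iff[OF \<psi>] simple_spectral_integral_comp[OF \<psi> simple_function_dyadic])

end

section \<open>Intertwining of spectral measures\<close>

text \<open>For a spectral measure this is the integral of the identity function. Applied to the
  image measures under \<open>\<psi>\<close> and \<open>\<phi>\<close> it represents both functions
  of the modulus in the same way.\<close>

definition dyadic_limit :: "(real set \<Rightarrow> 'a::chilbert_space \<Rightarrow> 'a) \<Rightarrow> 'a op_graph" where
  "dyadic_limit E = {(f, g). (\<lambda>n. simple_spectral_integral E (dyadic n) f) \<longlonglongrightarrow> g}"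

lemma (in spectral) spectral_integral_eq_dyadic_limit:
  "\<psi> \<in> measurable borel_Rp borel_Rp \<Longrightarrow>
    spectral_integral E \<psi> = dyadic_limit (\<lambda>\<sigma>. E (preim \<psi> \<sigma>))"
  by (auto simp: dyadic_limit_def spectral_integral_iff_preim)

lemma dyadic_abs_diff_le:
  assumes "x \<le> real n"
  shows "\<bar>dyadic n x - x\<bar> \<le> 1 / 2 ^ n"
proof -
  have "x - 1 / 2 ^ n \<le> real n"
    using assms by (rule order.trans[rotated]) simp
  then show ?thesis
    using dyadic_ge[of n x] dyadic_le[of n x] by (simp add: min_absorb2)
qed

context spectral
begin

lemma norm_simple_diff_le:
  assumes s: "simple_function borel_Rp s" and s': "simple_function borel_Rp s'"
    and S: "S \<in> sets borel_Rp" and d: "\<And>x. x \<in> S \<Longrightarrow> \<bar>s x - s' x\<bar> \<le> d" and "0 \<le> d"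
  shows "norm (E S (simple_spectral_integral E s f - simple_spectral_integral E s' f))
    \<le> d * norm (E S f)"
proof -
  have sq: "(s x - s' x)\<^sup>2 \<le> d\<^sup>2" if "x \<in> S" for x
    using d[OF that] \<open>0 \<le> d\<close> by (simp add: abs_le_square_iff[symmetric])
  have "ennreal ((norm (E S (simple_spectral_integral E s f - simple_spectral_integral E s' f)))\<^sup>2)
    \<le> (\<integral>\<^sup>+x. ennreal (d\<^sup>2) * indicator S x \<partial>scalar_measure E f)"
    unfolding norm_simple_diff[OF s s' S]
    using sq by (intro nn_integral_mono) (simp add: indicator_def ennreal_leI)
  also have "\<dots> = ennreal ((d * norm (E S f))\<^sup>2)"
    using S by (simp add: nn_integral_cmult_indicator emeasure_scalar power_mult_distrib ennreal_mult)
  finally have "(norm (E S (simple_spectral_integral E s f - simple_spectral_integral E s' f)))\<^sup>2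
      \<le> (d * norm (E S f))\<^sup>2"
    by (rule ennreal_le_iff[OF zero_le_power2, THEN iffD1])
  then show ?thesis
    by (rule power2_le_imp_le) (rule mult_nonneg_nonneg[OF \<open>0 \<le> d\<close> norm_ge_zero])
qed

lemma norm_simple_diff_ge:
  assumes s: "simple_function borel_Rp s" and s': "simple_function borel_Rp s'"
    and S: "S \<in> sets borel_Rp" and d: "\<And>x. x \<in> S \<Longrightarrow> d \<le> \<bar>s x - s' x\<bar>"
  shows "d * norm (E S f)
    \<le> norm (E S (simple_spectral_integral E s f - simple_spectral_integral E s' f))"
\<comment> \<open>Lower bounds of the form \<open>a - 1 / 2 ^ n\<close> will be inserted for
  \<open>d\<close>; these can be negative, and then the claim is trivial.\<close>
proof (cases "0 \<le> d")
  case True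
  have sq: "d\<^sup>2 \<le> (s x - s' x)\<^sup>2" if "x \<in> S" for x
    using d[OF that] True by (simp add: abs_le_square_iff[symmetric])
  have "ennreal ((d * norm (E S f))\<^sup>2) =
      (\<integral>\<^sup>+x. ennreal (d\<^sup>2) * indicator S x \<partial>scalar_measure E f)"
    using S by (simp add: nn_integral_cmult_indicator emeasure_scalar power_mult_distrib ennreal_mult)
  also have "\<dots> \<le>
      ennreal ((norm (E S (simple_spectral_integral E s f - simple_spectral_integral E s' f)))\<^sup>2)"
    unfolding norm_simple_diff[OF s s' S]
    using sq by (intro nn_integral_mono) (simp add: indicator_def ennreal_leI)
  finally have "(d * norm (E S f))\<^sup>2
      \<le> (norm (E S (simple_spectral_integral E s f - simple_spectral_integral E s' f)))\<^sup>2"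
    by (rule ennreal_le_iff[OF zero_le_power2, THEN iffD1])
  then show ?thesis
    by (rule power2_le_imp_le) (rule norm_ge_zero)
next
  case False
  then have "d * norm (E S f) \<le> 0" by (simp add: mult_nonpos_nonneg)
  then show ?thesis using norm_ge_zero order.trans by blast
qed

lemma simple_function_const: "simple_function borel_Rp (\<lambda>_. t)"
  by simp

text \<open>On the bounded set \<open>S\<close> the cap is inactive for large \<open>n\<close>, so
  \<open>dyadic n\<close> is within \<open>1 / 2 ^ n\<close> of the identity. The bounds for simple
  functions then pass to the limit.\<close>

lemma dyadic_limit_bounds:
  assumes fg: "(f, g) \<in> dyadic_limit E" and S: "S \<in> sets borel_Rp" "S \<subseteq> {..M}"
    and ab: "\<And>x. x \<in> S \<Longrightarrow> a \<le> \<bar>x - t\<bar> \<and> \<bar>x - t\<bar> \<le> b" and b: "0 \<le> b"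
  shows "a * norm (E S f) \<le> norm (E S (g - t *\<^sub>R f))"
    and "norm (E S (g - t *\<^sub>R f)) \<le> b * norm (E S f)"
proof -
  let ?N = "\<lambda>n. norm (E S (simple_spectral_integral E (dyadic n) f - t *\<^sub>R f))"
  obtain N where N: "M \<le> real N" using real_arch_simple by blast
  have lim: "?N \<longlonglongrightarrow> norm (E S (g - t *\<^sub>R f))"
    using fg by (intro tendsto_norm bounded_linear.tendsto[OF blin[OF S(1)]] tendsto_diff tendsto_const)
      (simp add: dyadic_limit_def)
  have near: "a - 1 / 2 ^ n \<le> \<bar>dyadic n x - t\<bar> \<and> \<bar>dyadic n x - t\<bar> \<le> b + 1 / 2 ^ n"
    if "n \<ge> N" "x \<in> S" for n x
  proof -
    have "x \<le> real n" using S(2) that N by (auto intro: order.trans)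
    then show ?thesis using dyadic_abs_diff_le[of x n] ab[OF that(2)] by linarith
  qed
  have e: "(\<lambda>n. 1 / 2 ^ n :: real) \<longlonglongrightarrow> 0"
    using LIMSEQ_inverse_realpow_zero[of 2] by (simp add: inverse_eq_divide)
  have "(\<lambda>n. (b + 1 / 2 ^ n) * norm (E S f)) \<longlonglongrightarrow> (b + 0) * norm (E S f)"
    by (intro tendsto_mult tendsto_add tendsto_const e)
  moreover have "?N n \<le> (b + 1 / 2 ^ n) * norm (E S f)" if "n \<ge> N" for n
    using norm_simple_diff_le[OF simple_function_dyadic simple_function_const S(1), of n t "b + 1 / 2 ^ n" f]
      near[OF that] b by (simp add: simple_const)
  ultimately show "norm (E S (g - t *\<^sub>R f)) \<le> b * norm (E S f)"
    using LIMSEQ_le[OF lim] by force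
  have "(\<lambda>n. (a - 1 / 2 ^ n) * norm (E S f)) \<longlonglongrightarrow> (a - 0) * norm (E S f)"
    by (intro tendsto_mult tendsto_diff tendsto_const e)
  moreover have "(a - 1 / 2 ^ n) * norm (E S f) \<le> ?N n" if "n \<ge> N" for n
    using norm_simple_diff_ge[OF simple_function_dyadic simple_function_const S(1), of "a - 1 / 2 ^ n" n t f]
      near[OF that] by (simp add: simple_const)
  ultimately show "a * norm (E S f) \<le> norm (E S (g - t *\<^sub>R f))"
    using LIMSEQ_le[OF _ lim] by force
qed

text \<open>Uniform convergence of \<open>dyadic n\<close> on \<open>S\<close> makes the sums
  Cauchy. The bounded spectral subspace is thus inside the domain and invariant, so the operator can
  be iterated on it.\<close>

lemma dyadic_limit_exists:
  assumes S: "S \<in> sets borel_Rp" "S \<subseteq> {..M}" and f: "E S f = f"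
  obtains g where "(f, g) \<in> dyadic_limit E" "E S g = g"
proof -
  let ?D = "\<lambda>n. simple_spectral_integral E (dyadic n) f"
  obtain N where N: "M \<le> real N" using real_arch_simple by blast
  have ED: "E S (?D n) = ?D n" for n
    by (simp add: E_simple_commute[OF simple_function_dyadic S(1)] f)
  have le: "norm (?D m - ?D n) \<le> (1 / 2 ^ m + 1 / 2 ^ n) * norm f" if mn: "m \<ge> N" "n \<ge> N" for m n
  proof -
    have "\<bar>dyadic m x - dyadic n x\<bar> \<le> 1 / 2 ^ m + 1 / 2 ^ n" if "x \<in> S" for x
    proof -
      have "x \<le> real m" "x \<le> real n" using S(2) that N mn by (auto intro: order.trans)
      then show ?thesis using dyadic_abs_diff_le[of x n] dyadic_abs_diff_le[of x m] by linarith
    qed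
    then have "norm (E S (?D m - ?D n)) \<le> (1 / 2 ^ m + 1 / 2 ^ n) * norm (E S f)"
      by (intro norm_simple_diff_le simple_function_dyadic S) auto
    then show ?thesis by (simp add: linear_diff[OF lin[OF S(1)]] ED f)
  qed
  have "Cauchy ?D"
  proof (rule metric_CauchyI)
    fix e :: real assume e: "0 < e"
    have "(\<lambda>n. (1 / 2 ^ n) * norm f) \<longlonglongrightarrow> 0 * norm f"
      using LIMSEQ_inverse_realpow_zero[of 2]
      by (intro tendsto_mult tendsto_const) (simp add: inverse_eq_divide)
    then have "\<forall>\<^sub>F n in sequentially. (1 / 2 ^ n) * norm f < e / 2"
      using e by (intro order_tendstoD(2)) auto
    then obtain K where K: "\<And>n. n \<ge> K \<Longrightarrow> (1 / 2 ^ n) * norm f < e / 2"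
      by (auto simp: eventually_sequentially)
    have "dist (?D m) (?D n) < e" if mn: "m \<ge> max K N" "n \<ge> max K N" for m n
    proof -
      have "dist (?D m) (?D n) \<le> (1 / 2 ^ m) * norm f + (1 / 2 ^ n) * norm f"
        using le[of m n] mn by (simp only: dist_norm distrib_right max.bounded_iff)
      then show ?thesis using K[of m] K[of n] mn by linarith
    qed
    then show "\<exists>K. \<forall>m\<ge>K. \<forall>n\<ge>K. dist (?D m) (?D n) < e" by blast
  qed
  then obtain g where g: "?D \<longlonglongrightarrow> g" by (auto simp: Cauchy_convergent_iff convergent_def)
  have "(\<lambda>n. E S (?D n)) \<longlonglongrightarrow> E S g" by (rule bounded_linear.tendsto[OF blin[OF S(1)] g])
  then have "E S g = g" using g by (simp add: ED LIMSEQ_unique)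
  with g show ?thesis by (intro that) (simp_all add: dyadic_limit_def)
qed

end

text \<open>Only boundedness of \<open>T\<close> is fixed here; the intertwining relation is a
  hypothesis in one direction and the conclusion in the other.\<close>

locale intertwining = E: spectral E + F: spectral F
  for E F :: "real set \<Rightarrow> 'a::chilbert_space \<Rightarrow> 'a" +
  fixes T :: "'a \<Rightarrow> 'a"
  assumes blinT: "bounded_linear T"
begin

lemma linT: "linear T" by (rule bounded_linear.linear[OF blinT])

lemma simple_intertwine:
  assumes "\<And>\<sigma> f. \<sigma> \<in> sets borel_Rp \<Longrightarrow> T (E \<sigma> f) = F \<sigma> (T f)" and "simple_function borel_Rp s"
  shows "T (simple_spectral_integral E s f) = simple_spectral_integral F s (T f)"
  by (simp add: simple_spectral_integral_def linear_sum[OF linT] linear_scale[OF linT]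
      assms(1)[OF preim_simple(2)[OF assms(2)]])

lemma dyadic_limit_intertwine:
  assumes "\<And>\<sigma> f. \<sigma> \<in> sets borel_Rp \<Longrightarrow> T (E \<sigma> f) = F \<sigma> (T f)" and "(f, g) \<in> dyadic_limit E"
  shows "(T f, T g) \<in> dyadic_limit F"
  using bounded_linear.tendsto[OF blinT] assms(2)
  by (simp add: dyadic_limit_def simple_intertwine[OF assms(1) simple_function_dyadic, symmetric])

context
  assumes comm: "\<And>f g. (f, g) \<in> dyadic_limit E \<Longrightarrow> (T f, T g) \<in> dyadic_limit F"
begin

text \<open>Write \<open>B\<close> and \<open>C\<close> for the operators of \<open>E\<close> and \<open>F\<close>. For \<open>f\<close> in the range of \<open>E \<sigma>\<close>,
  \<open>F \<tau> T (B - t)\<^sup>n f = (C - t)\<^sup>n F \<tau> T f\<close> grows at most like \<open>\<alpha>\<^sup>n\<close> by the left-hand side and at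
  least like \<open>\<beta>\<^sup>n\<close> by the right-hand side.\<close>

lemma separated_zero:
  assumes S: "\<sigma> \<in> sets borel_Rp" "\<sigma> \<subseteq> {..M}" "\<And>x. x \<in> \<sigma> \<Longrightarrow> \<bar>x - t\<bar> \<le> \<alpha>"
    and R: "\<tau> \<in> sets borel_Rp" "\<tau> \<subseteq> {..M}" "\<And>x. x \<in> \<tau> \<Longrightarrow> \<beta> \<le> \<bar>x - t\<bar>"
    and ab: "0 \<le> \<alpha>" "\<alpha> < \<beta>"
  shows "F \<tau> (T (E \<sigma> f)) = 0"
proof -
  obtain K where K: "K \<ge> 0" "\<And>x. norm (T x) \<le> norm x * K"
    using bounded_linear.nonneg_bounded[OF blinT] by blast
  \<comment> \<open>The vector \<open>f\<close> must vary in the induction: the step replaces it by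
    \<open>h = (B - t) f\<close>, again in the range of \<open>E \<sigma>\<close>, at the cost of
    one factor \<open>\<alpha>\<close> and the gain of one factor \<open>\<beta>\<close>.\<close>
  have pow: "\<beta> ^ n * norm (F \<tau> (T f)) \<le> \<alpha> ^ n * (norm f * K)" if "E \<sigma> f = f" for n f
    using that
  proof (induction n arbitrary: f)
    case 0
    show ?case using F.norm_le[OF R(1), of "T f"] K(2)[of f] by simp
  next
    case (Suc n)
    obtain g where g: "(f, g) \<in> dyadic_limit E" "E \<sigma> g = g"
      using E.dyadic_limit_exists[OF S(1,2) Suc.prems] by blast
    define h where "h = g - t *\<^sub>R f"
    have Eh: "E \<sigma> h = h"
      by (simp add: h_def linear_diff[OF E.lin[OF S(1)]] linear_scale[OF E.lin[OF S(1)]] g(2) Suc.prems)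
    have hle: "norm h \<le> \<alpha> * norm f"
      using E.dyadic_limit_bounds(2)[OF g(1) S(1,2), of 0 t \<alpha>] S(3) ab
      by (simp add: Eh[unfolded h_def] Suc.prems h_def)
    have "\<bar>x - t\<bar> \<le> M + \<bar>t\<bar>" if "x \<in> \<tau>" for x
    proof -
      have "0 \<le> x" "x \<le> M" using R(2) borel_Rp_subset[OF R(1)] that by auto
      then show ?thesis by linarith
    qed
    \<comment> \<open>The absolute value of \<open>M\<close> makes this bound nonnegative even if
      \<open>\<tau>\<close> is empty and \<open>M\<close> negative.\<close>
    then have "\<bar>x - t\<bar> \<le> \<bar>M\<bar> + \<bar>t\<bar>" if "x \<in> \<tau>" for x
      using that by (meson abs_ge_self add_right_mono order.trans)
    then have "\<beta> * norm (F \<tau> (T f)) \<le> norm (F \<tau> (T g - t *\<^sub>R T f))"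
      using F.dyadic_limit_bounds(1)[OF comm[OF g(1)] R(1,2), of \<beta> t "\<bar>M\<bar> + \<bar>t\<bar>"] R(3) by force
    also have "T g - t *\<^sub>R T f = T h"
      by (simp add: h_def linear_diff[OF linT] linear_scale[OF linT])
    finally have "\<beta> ^ Suc n * norm (F \<tau> (T f)) \<le> \<beta> ^ n * norm (F \<tau> (T h))"
      using ab by (simp add: mult.assoc mult_left_mono)
    also have "\<dots> \<le> \<alpha> ^ n * (norm h * K)" by (rule Suc.IH[OF Eh])
    also have "\<dots> \<le> \<alpha> ^ n * (\<alpha> * norm f * K)"
      using hle K(1) ab by (intro mult_left_mono mult_right_mono) auto
    finally show ?case by (simp add: mult_ac)
  qed
  have "norm (F \<tau> (T (E \<sigma> f))) \<le> (\<alpha> / \<beta>) ^ n * (norm (E \<sigma> f) * K)" for n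
    using pow[OF E.idem[OF S(1)], of n f] ab
    by (simp add: power_divide field_simps)
  moreover have "(\<lambda>n. (\<alpha> / \<beta>) ^ n * (norm (E \<sigma> f) * K)) \<longlonglongrightarrow> 0 * (norm (E \<sigma> f) * K)"
    using ab by (intro tendsto_mult tendsto_const LIMSEQ_realpow_zero) auto
  ultimately have "norm (F \<tau> (T (E \<sigma> f))) \<le> 0"
    using LIMSEQ_le_const by force
  then show ?thesis by simp
qed

text \<open>Both off-diagonal corners of \<open>T\<close> with respect to \<open>{0..a}\<close> and
  \<open>{a<..}\<close> vanish. Each follows from \<open>separated_zero\<close> after exhausting
  \<open>{a<..}\<close> by bounded intervals.\<close>

lemma intertwine_initial_segment:
  assumes a: "0 \<le> a"
  shows "T (E {0..a} f) = F {0..a} (T f)"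
proof -
  \<comment> \<open>The left end keeps a positive distance from \<open>a\<close>, for strict
    separation; the right end keeps the interval bounded.\<close>
  define J where "J n = {a + 1 / real (Suc n) .. a + real (Suc n)}" for n
  have J_sets: "J n \<in> sets borel_Rp" "range J \<subseteq> sets borel_Rp" for n
    using a by (auto simp: J_def sets_restrict_space_iff intro!: order.trans[OF a])
  have I_sets: "{0..a} \<in> sets borel_Rp" "{a<..} \<in> sets borel_Rp"
    using a by (auto simp: sets_restrict_space_iff)
  have inc: "incseq J"
    unfolding J_def by (intro monoI) (auto intro!: divide_left_mono intro: order.trans)
  have un: "(\<Union>n. J n) = {a<..}"
  proof (intro equalityI subsetI)
    fix x assume "x \<in> {a<..}"
    then have x: "x - a > 0" by simp
    obtain n where n: "inverse (real (Suc n)) < x - a" using reals_Archimedean[OF x] by blast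
    obtain m where m: "x - a \<le> real m" using real_arch_simple by blast
    have "inverse (real (Suc (max m n))) \<le> inverse (real (Suc n))" by (simp add: field_simps)
    with n m have "x \<in> J (max m n)" by (auto simp: J_def inverse_eq_divide max_def)
    then show "x \<in> (\<Union>n. J n)" by blast
  next
    fix x assume "x \<in> (\<Union>n. J n)"
    then obtain n where "a + 1 / real (Suc n) \<le> x" by (auto simp: J_def)
    moreover have "1 / real (Suc n) > 0" by simp
    ultimately have "a < x" by linarith
    then show "x \<in> {a<..}" by simp
  qed
  \<comment> \<open>Seen from \<open>t = 0\<close>, the segment \<open>{0..a}\<close> is closer than
    \<open>J n\<close>.\<close>
  have "F (J n) (T (E {0..a} f)) = 0" for n f
    by (rule separated_zero[where M = "a + real (Suc n)" and t = 0 and \<alpha> = a and \<beta> = "a + 1 / real (Suc n)"])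
      (use a I_sets J_sets in \<open>auto simp: J_def intro: order.trans\<close>)
  then have up: "F {a<..} (T (E {0..a} f)) = 0" for f
    using F.incseq_limit[OF J_sets(2) inc, of "T (E {0..a} f)"] by (simp add: un LIMSEQ_const_iff)
  \<comment> \<open>Seen from the right end of \<open>J n\<close>, the roles are exchanged: points
    of \<open>J n\<close> are within \<open>real (Suc n) - 1 / real (Suc n)\<close>, points of
    \<open>{0..a}\<close> at least \<open>real (Suc n)\<close> away.\<close>
  have "F {0..a} (T (E (J n) f)) = 0" for n
    by (rule separated_zero[where M = "a + real (Suc n)" and t = "a + real (Suc n)"
          and \<alpha> = "real (Suc n) - 1 / real (Suc n)" and \<beta> = "real (Suc n)"])
      (use a I_sets J_sets in \<open>auto simp: J_def field_simps\<close>)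
  moreover have "(\<lambda>n. F {0..a} (T (E (J n) f))) \<longlonglongrightarrow> F {0..a} (T (E {a<..} f))"
    using E.incseq_limit[OF J_sets(2) inc, of f] unfolding un
    by (intro bounded_linear.tendsto[OF F.blin[OF I_sets(1)]] bounded_linear.tendsto[OF blinT])
  ultimately have down: "F {0..a} (T (E {a<..} f)) = 0"
    by (simp add: LIMSEQ_const_iff)
  have co: "{0..} - {0..a} = {a<..}" using a by auto
  have "T (E {0..a} f) = F {0..a} (T (E {0..a} f))"
    using F.compl(1)[OF I_sets(1), of "T (E {0..a} f)"] up by (simp add: co)
  also have "\<dots> = F {0..a} (T f) - F {0..a} (T (E {a<..} f))"
    using E.compl(1)[OF I_sets(1), of f]
    by (simp add: co linear_diff[OF linT] linear_diff[OF F.lin[OF I_sets(1)]])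
  finally show ?thesis by (simp add: down)
qed

text \<open>The half-lines \<open>{..a}\<close> form an intersection-stable generator of the Borel
  sets, and the relation survives complements and countable disjoint unions. Intersecting with
  \<open>{0..}\<close> lets the induction run over Borel sets of the whole line.\<close>

lemma intertwine:
  assumes "\<sigma> \<in> sets borel_Rp"
  shows "T (E \<sigma> f) = F \<sigma> (T f)"
proof -
  have R: "{0..} \<inter> B \<in> sets borel_Rp" if "B \<in> sets borel" for B :: "real set"
    using that by (auto simp: sets_restrict_space)
  have b: "sets borel = sigma_sets UNIV (range (\<lambda>a::real. {..a}))"
    by (subst borel_eq_atMost) simp
  have "\<forall>f. T (E ({0..} \<inter> B) f) = F ({0..} \<inter> B) (T f)" if "B \<in> sets borel" for B
  proof -
    have "Int_stable (range (\<lambda>a::real. {..a}))"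
    proof (rule Int_stableI)
      fix A B :: "real set" assume "A \<in> range (\<lambda>a. {..a})" "B \<in> range (\<lambda>a. {..a})"
      then obtain a b where "A = {..a}" "B = {..b}" by blast
      then have "A \<inter> B = {..min a b}" by auto
      then show "A \<inter> B \<in> range (\<lambda>a. {..a})" by blast
    qed
    moreover have "range (\<lambda>a::real. {..a}) \<subseteq> Pow UNIV" by simp
    moreover have "B \<in> sigma_sets UNIV (range (\<lambda>a::real. {..a}))" using that by (simp only: b)
    ultimately show ?thesis
    proof (induction rule: sigma_sets_induct_disjoint)
      case (basic A)
      then obtain a where "A = {..a}" by auto
      then have A: "{0..} \<inter> A = {0..a}" by auto
      show ?case
        using intertwine_initial_segment[of a] by (cases "0 \<le> a") (auto simp: A linear_0[OF linT])
    next
      case empty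
      show ?case by (simp add: linear_0[OF linT])
    next
      case (compl A)
      have A: "{0..} \<inter> A \<in> sets borel_Rp" using compl(1) by (intro R) (simp only: b)
      have "{0..} \<inter> (UNIV - A) = {0..} - ({0..} \<inter> A)" by auto
      then show ?case
        using compl(2) by (simp only: E.compl(1)[OF A] F.compl(1)[OF A] linear_diff[OF linT]) simp
    next
      case (union A)
      have A: "range (\<lambda>n. {0..} \<inter> A n) \<subseteq> sets borel_Rp" "disjoint_family (\<lambda>n. {0..} \<inter> A n)"
        using union(1,2) R by (auto simp: disjoint_family_on_def b)
      show ?case
      proof
        fix f
        have "(\<lambda>n. T (E ({0..} \<inter> A n) f)) sums T (E (\<Union>n. {0..} \<inter> A n) f)"
          by (intro bounded_linear.sums[OF blinT] E.sums_E A)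
        moreover have "(\<lambda>n. F ({0..} \<inter> A n) (T f)) sums F (\<Union>n. {0..} \<inter> A n) (T f)"
          by (intro F.sums_E A)
        ultimately show "T (E ({0..} \<inter> \<Union> (range A)) f) = F ({0..} \<inter> \<Union> (range A)) (T f)"
          using union(3) unfolding Int_UN_distrib by (simp only: sums_unique2)
      qed
    qed
  qed
  moreover obtain B where "B \<in> sets borel" "\<sigma> = {0..} \<inter> B"
    using assms by (auto simp: sets_restrict_space)
  ultimately show ?thesis by blast
qed

end

end

section \<open>Extension of operators\<close>

text \<open>The norm bound, applied to the difference of two values at the same point, makes the
  relation single-valued.\<close>

lemma bounded_clinear_of_graph:
  fixes R :: "'a::chilbert_space op_graph"
  assumes R: "csubspace R" and total: "\<And>x. x \<in> Domain R"
    and le: "\<And>x v. (x, v) \<in> R \<Longrightarrow> norm v \<le> C * norm x" and C: "0 \<le> C"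
  obtains T where "bounded_clinear T" "onorm T \<le> C" "\<And>x v. (x, v) \<in> R \<longleftrightarrow> v = T x"
proof -
  have uniq: "v = w" if "(x, v) \<in> R" "(x, w) \<in> R" for x v w
    using le[OF csubspace_pair_diff[OF R that]] by simp
  have "\<forall>x. \<exists>v. (x, v) \<in> R" using total by blast
  then obtain T where T: "\<And>x. (x, T x) \<in> R" by metis
  have T_iff: "(x, v) \<in> R \<longleftrightarrow> v = T x" for x v using T uniq by blast
  have add: "T (x + y) = T x + T y" for x y
    using csubspace_pair_add[OF R T T] by (simp add: T_iff)
  have scale: "T (a *\<^sub>C x) = a *\<^sub>C T x" for a x
    using csubspace_pair_scaleC[OF R T] by (simp add: T_iff)
  have bound: "norm (T x) \<le> C * norm x" for x using le[OF T] .
  have "bounded_linear T"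
    using bound by (intro bounded_linear_intro[where K = C])
      (simp_all add: add scaleR_scaleC scale mult.commute)
  with scale show ?thesis
    using onorm_bound[OF C bound] T_iff by (intro that) (auto simp: bounded_clinear_def)
qed

text \<open>A partially defined operator \<open>K\<close> is extended by \<open>0\<close> on the orthogonal complement of
  the closure of its domain.\<close>

lemma bounded_extension:
  fixes K :: "'a::chilbert_space op_graph"
  assumes K: "csubspace K" and le: "\<And>u v. (u, v) \<in> K \<Longrightarrow> norm v \<le> C * norm u" and C: "0 \<le> C"
  obtains T where "bounded_clinear T" "onorm T \<le> C" "\<And>u v. (u, v) \<in> K \<Longrightarrow> T u = v"
    and "\<And>G F. orth_proj G \<Longrightarrow> bounded_linear F \<Longrightarrow> (\<And>u v. (u, v) \<in> K \<Longrightarrow> (G u, F v) \<in> K) \<Longrightarrow>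
      T \<circ> G = F \<circ> T"
proof -
  let ?K = "closure K"
  note cK = csubspace_closure[OF K]
  have le': "norm v \<le> C * norm u" if uv: "(u, v) \<in> ?K" for u v
  proof -
    obtain x where x: "\<And>n. x n \<in> K" "x \<longlonglongrightarrow> (u, v)"
      using uv unfolding closure_sequential by blast
    have "(\<lambda>n. norm (snd (x n))) \<longlonglongrightarrow> norm v" "(\<lambda>n. C * norm (fst (x n))) \<longlonglongrightarrow> C * norm u"
      using tendsto_norm[OF tendsto_snd[OF x(2)]]
        tendsto_mult[OF tendsto_const tendsto_norm[OF tendsto_fst[OF x(2)]]] by simp_all
    then show ?thesis
      by (rule LIMSEQ_le) (use le[of "fst (x n)" "snd (x n)" for n] x(1) in auto)
  qed
  have cD: "csubspace (Domain ?K)"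
    unfolding csubspace_def
    using csubspace_pair_zero[OF cK] csubspace_pair_add[OF cK] csubspace_pair_scaleC[OF cK]
    by (simp add: Domain_iff) blast
  \<comment> \<open>By the bound, values along a convergent sequence of arguments are Cauchy, so
    completeness supplies a value at the limit.\<close>
  have clD: "closed (Domain ?K)"
    unfolding closed_sequential_limits
  proof (intro allI impI, elim conjE)
    fix u l assume u: "\<forall>n::nat. u n \<in> Domain ?K" "u \<longlonglongrightarrow> l"
    then obtain v where v: "\<And>n. (u n, v n) \<in> ?K" by (meson DomainE)
    have "Cauchy v"
    proof (rule metric_CauchyI)
      fix e :: real assume e: "0 < e"
      have "Cauchy u" using u(2) by (rule LIMSEQ_imp_Cauchy)
      \<comment> \<open>Dividing by \<open>C + 1\<close> also covers \<open>C = 0\<close>.\<close>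
      then obtain N where N: "\<And>m n. m \<ge> N \<Longrightarrow> n \<ge> N \<Longrightarrow> dist (u m) (u n) < e / (C + 1)"
        using metric_CauchyD[of u "e / (C + 1)"] e C by auto
      have "dist (v m) (v n) < e" if "m \<ge> N" "n \<ge> N" for m n
      proof -
        have "dist (v m) (v n) \<le> C * dist (u m) (u n)"
          using le'[OF csubspace_pair_diff[OF cK v v], of m n] by (simp add: dist_norm)
        also have "\<dots> \<le> C * (e / (C + 1))"
          using N[OF that] C by (intro mult_left_mono) auto
        also have "\<dots> < e" using e C by (simp add: pos_divide_less_eq)
        finally show ?thesis .
      qed
      then show "\<exists>N. \<forall>m\<ge>N. \<forall>n\<ge>N. dist (v m) (v n) < e" by blast
    qed
    then obtain w where w: "v \<longlonglongrightarrow> w" by (auto simp: Cauchy_convergent_iff convergent_def)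
    have "(l, w) \<in> ?K"
      by (rule closed_sequentially[OF closed_closure _ tendsto_Pair[OF u(2) w]]) (rule v)
    then show "l \<in> Domain ?K" by blast
  qed
  \<comment> \<open>Here \<open>q\<close> is the projection of \<open>x\<close> onto the closed
    domain and \<open>v\<close> the value at \<open>q\<close>. As a relation, \<open>R\<close> is
    linear without choosing projections.\<close>
  define R where "R = {(x, v). \<exists>q. (q, v) \<in> ?K \<and> (\<forall>s\<in>Domain ?K. cinner (x - q) s = 0)}"
  have cR: "csubspace R"
    unfolding csubspace_def
  proof (intro conjI ballI allI)
    show "0 \<in> R"
      using csubspace_pair_zero[OF cK] by (auto simp: R_def zero_prod_def intro!: exI[of _ 0])
  next
    fix x y assume "x \<in> R" "y \<in> R"
    then obtain a v q b w r where "x = (a, v)" "(q, v) \<in> ?K" "\<forall>s\<in>Domain ?K. cinner (a - q) s = 0"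
      "y = (b, w)" "(r, w) \<in> ?K" "\<forall>s\<in>Domain ?K. cinner (b - r) s = 0"
      by (auto simp: R_def)
    moreover from this have "cinner (a + b - (q + r)) s = 0" if "s \<in> Domain ?K" for s
      using that by (simp only: add_diff_add cinner_add_left add_0_left)
    ultimately show "x + y \<in> R"
      using csubspace_pair_add[OF cK, of q v r w] unfolding R_def
      by (auto intro!: exI[of _ "q + r"])
  next
    fix t x assume "x \<in> R"
    then obtain a v q where "x = (a, v)" "(q, v) \<in> ?K" "\<forall>s\<in>Domain ?K. cinner (a - q) s = 0"
      by (auto simp: R_def)
    then show "t *\<^sub>C x \<in> R"
      using csubspace_pair_scaleC[OF cK, of q v t] unfolding R_def
      by (auto intro!: exI[of _ "t *\<^sub>C q"]
          simp: scaleC_prod_def scaleC_diff_right[symmetric] cinner_scaleC_left)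
  qed
  have totR: "x \<in> Domain R" for x
    using projection_exists[OF cD clD, of x] by (auto simp: R_def Domain_iff)
  have leR: "norm v \<le> C * norm x" if xv: "(x, v) \<in> R" for x v
  proof -
    obtain q where q: "(q, v) \<in> ?K" "\<And>s. s \<in> Domain ?K \<Longrightarrow> cinner (x - q) s = 0"
      using xv unfolding R_def by blast
    have "cinner (x - q) q = 0" using q by blast
    then have "(norm x)\<^sup>2 = (norm (x - q))\<^sup>2 + (norm q)\<^sup>2"
      using norm_sq_add[of "x - q" q] by simp
    then have "(norm q)\<^sup>2 \<le> (norm x)\<^sup>2" by simp
    then have "norm q \<le> norm x" by (rule power2_le_imp_le) simp
    then have "C * norm q \<le> C * norm x" using C by (rule mult_left_mono)
    with le'[OF q(1)] show ?thesis by linarith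
  qed
  obtain T where T: "bounded_clinear T" "onorm T \<le> C" "\<And>x v. (x, v) \<in> R \<longleftrightarrow> v = T x"
    using bounded_clinear_of_graph[OF cR totR leR C] by blast
  show ?thesis
  proof (rule that[OF T(1,2)])
    fix u v assume "(u, v) \<in> K"
    then have "(u, v) \<in> R"
      using closure_subset[of K] by (auto simp: R_def intro!: exI[of _ u])
    then show "T u = v" by (simp add: T(3))
  next
    fix G F :: "'a \<Rightarrow> 'a"
    assume G: "orth_proj G" and F: "bounded_linear F"
      and inv: "\<And>u v. (u, v) \<in> K \<Longrightarrow> (G u, F v) \<in> K"
    have blG: "bounded_linear G" using G by (simp add: orth_proj_def bounded_clinear_def)
    have inv': "(G u, F v) \<in> ?K" if uv: "(u, v) \<in> ?K" for u v
    proof -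
      obtain x where x: "\<And>n. x n \<in> K" "x \<longlonglongrightarrow> (u, v)"
        using uv unfolding closure_sequential by blast
      have "(\<lambda>n. (G (fst (x n)), F (snd (x n)))) \<longlonglongrightarrow> (G u, F v)"
        using bounded_linear.tendsto[OF blG tendsto_fst[OF x(2)]]
          bounded_linear.tendsto[OF F tendsto_snd[OF x(2)]] by (simp add: tendsto_Pair)
      moreover have "(G (fst (x n)), F (snd (x n))) \<in> K" for n
        using x(1)[of n] by (intro inv) simp
      ultimately show ?thesis
        unfolding closure_sequential by (intro exI[of _ "\<lambda>n. (G (fst (x n)), F (snd (x n)))"]) simp
    qed
    show "T \<circ> G = F \<circ> T"
    proof
      fix x
      have "(x, T x) \<in> R" by (simp add: T(3))
      then obtain q where q: "(q, T x) \<in> ?K" "\<And>s. s \<in> Domain ?K \<Longrightarrow> cinner (x - q) s = 0"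
        by (auto simp: R_def)
      \<comment> \<open>The symmetric map \<open>G\<close> leaves the closed domain invariant, hence
        also its orthogonal complement.\<close>
      have "cinner (G x - G q) s = 0" if "s \<in> Domain ?K" for s
      proof -
        have "cinner (G x - G q) s = cinner (x - q) (G s)"
          using G by (simp add: orth_proj_def linear_diff[OF bounded_linear.linear[OF blG], symmetric])
        also have "\<dots> = 0" using that inv' by (intro q(2)) blast
        finally show ?thesis .
      qed
      then have "(G x, F (T x)) \<in> R" using inv'[OF q(1)] by (auto simp: R_def)
      then show "(T \<circ> G) x = (F \<circ> T) x" by (simp add: T(3))
    qed
  qed
qed

text \<open>Pairs are combined only along complementary sets, so bounds on squared norms add up.
  Pasting with \<open>(0, 0)\<close> applies \<open>G \<sigma>\<close> and \<open>F \<sigma>\<close>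
  to a pair, which is the invariance that produces an intertwiner.\<close>

inductive_set pasting ::
    "(real set \<Rightarrow> 'a::chilbert_space \<Rightarrow> 'a) \<Rightarrow> (real set \<Rightarrow> 'a \<Rightarrow> 'a) \<Rightarrow> 'a op_graph \<Rightarrow> 'a op_graph"
  for G F K where
    base: "(u, v) \<in> K \<Longrightarrow> (u, v) \<in> pasting G F K"
  | paste: "(u, v) \<in> pasting G F K \<Longrightarrow> (u', v') \<in> pasting G F K \<Longrightarrow> \<sigma> \<in> sets borel_Rp \<Longrightarrow>
      (G \<sigma> u + G ({0..} - \<sigma>) u', F \<sigma> v + F ({0..} - \<sigma>) v') \<in> pasting G F K"

lemma compl_in_borel_Rp: "\<sigma> \<in> sets borel_Rp \<Longrightarrow> {0..} - \<sigma> \<in> sets borel_Rp"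
  by (rule sets.Diff[OF atLeast_0_in_borel_Rp])

text \<open>The set \<open>\<rho>\<close> splits along \<open>\<sigma>\<close> into two disjoint
  pieces, and on each piece only one of the pasted vectors is seen.\<close>

lemma (in spectral) norm_paste:
  assumes r: "\<rho> \<in> sets borel_Rp" and s: "\<sigma> \<in> sets borel_Rp"
  shows "(norm (E \<rho> (E \<sigma> u + E ({0..} - \<sigma>) u')))\<^sup>2 =
    (norm (E (\<rho> \<inter> \<sigma>) u))\<^sup>2 + (norm (E (\<rho> - \<sigma>) u'))\<^sup>2"
proof -
  define w where "w = E \<sigma> u + E ({0..} - \<sigma>) u'"
  note s' = compl_in_borel_Rp[OF s]
  have rs: "\<rho> \<inter> \<sigma> \<in> sets borel_Rp" "\<rho> - \<sigma> \<in> sets borel_Rp" using r s by auto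
  have sets: "\<rho> \<inter> \<sigma> \<inter> \<sigma> = \<rho> \<inter> \<sigma>" "\<rho> \<inter> \<sigma> \<inter> ({0..} - \<sigma>) = {}" "(\<rho> - \<sigma>) \<inter> \<sigma> = {}"
      "(\<rho> - \<sigma>) \<inter> ({0..} - \<sigma>) = \<rho> - \<sigma>" "\<rho> \<inter> \<sigma> \<union> (\<rho> - \<sigma>) = \<rho>" "\<rho> \<inter> \<sigma> \<inter> (\<rho> - \<sigma>) = {}"
    using borel_Rp_subset[OF r] by auto
  have "E (\<rho> \<inter> \<sigma>) w = E (\<rho> \<inter> \<sigma>) u" "E (\<rho> - \<sigma>) w = E (\<rho> - \<sigma>) u'"
    by (simp_all add: w_def linear_add[OF lin] rs mult s s' sets)
  then show ?thesis
    using norm_union[OF rs sets(6), of w] by (simp add: sets(5) w_def)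
qed

lemma spectral_bound_extension:
  fixes G F :: "real set \<Rightarrow> 'a::chilbert_space \<Rightarrow> 'a"
  assumes G: "spectral_measure G" and F: "spectral_measure F" and K: "csubspace K" and c: "0 \<le> c"
    and le: "\<And>u v \<rho>. (u, v) \<in> K \<Longrightarrow> \<rho> \<in> sets borel_Rp \<Longrightarrow> (norm (F \<rho> v))\<^sup>2 \<le> c * (norm (G \<rho> u))\<^sup>2"
  obtains T where "bounded_clinear T" "onorm T \<le> sqrt c" "\<And>u v. (u, v) \<in> K \<Longrightarrow> T u = v"
    "\<And>\<sigma>. \<sigma> \<in> sets borel_Rp \<Longrightarrow> T \<circ> G \<sigma> = F \<sigma> \<circ> T"
proof -
  interpret G: spectral G by (unfold_locales) (rule G)
  interpret F: spectral F by (unfold_locales) (rule F)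
  let ?P = "pasting G F K"
  note co = compl_in_borel_Rp
  \<comment> \<open>Quantifying over all \<open>\<rho>\<close> makes the induction work: the bound
    at \<open>\<rho>\<close> for a pasted pair uses the bounds at
    \<open>\<rho> \<inter> \<sigma>\<close> and \<open>\<rho> - \<sigma>\<close>.\<close>
  have bound: "(norm (F \<rho> v))\<^sup>2 \<le> c * (norm (G \<rho> u))\<^sup>2"
    if "(u, v) \<in> ?P" "\<rho> \<in> sets borel_Rp" for u v \<rho>
    using that
  proof (induction arbitrary: \<rho> rule: pasting.induct)
    case (base u v)
    then show ?case by (rule le)
  next
    case (paste u v u' v' \<sigma>)
    have "\<rho> \<inter> \<sigma> \<in> sets borel_Rp" "\<rho> - \<sigma> \<in> sets borel_Rp" using paste.hyps paste.prems by auto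
    from paste.IH(1)[OF this(1)] paste.IH(2)[OF this(2)] show ?case
      by (simp add: F.norm_paste[OF paste.prems paste.hyps(3)]
          G.norm_paste[OF paste.prems paste.hyps(3)] distrib_left)
  qed
  have zero: "(0, 0) \<in> ?P" using csubspace_pair_zero[OF K] by (rule pasting.base)
  \<comment> \<open>Additivity takes two inductions, first with a fixed addend in \<open>K\<close>,
    then with one in \<open>?P\<close>. A fixed addend can be moved inside a pasting because its
    pieces on \<open>\<sigma>\<close> and on the complement add up to it.\<close>
  have add_base: "(u + a, v + b) \<in> ?P" if "(u, v) \<in> ?P" "(a, b) \<in> K" for u v a b
    using that
  proof (induction rule: pasting.induct)
    case (base u v)
    then show ?case using csubspace_pair_add[OF K] pasting.base by blast
  next
    case (paste u v u' v' \<sigma>)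
    have "G \<sigma> (u + a) + G ({0..} - \<sigma>) (u' + a) = (G \<sigma> u + G ({0..} - \<sigma>) u') + a"
      by (simp add: linear_add[OF G.lin] paste.hyps(3) co G.compl(1))
    moreover have "F \<sigma> (v + b) + F ({0..} - \<sigma>) (v' + b) = (F \<sigma> v + F ({0..} - \<sigma>) v') + b"
      by (simp add: linear_add[OF F.lin] paste.hyps(3) co F.compl(1))
    ultimately show ?case
      using pasting.paste[OF paste.IH(1)[OF paste.prems] paste.IH(2)[OF paste.prems] paste.hyps(3)] by metis
  qed
  have add: "(a + u, b + v) \<in> ?P" if "(u, v) \<in> ?P" "(a, b) \<in> ?P" for u v a b
    using that
  proof (induction rule: pasting.induct)
    case (base u v)
    then show ?case using add_base by blast
  next
    case (paste u v u' v' \<sigma>)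
    have "G \<sigma> (a + u) + G ({0..} - \<sigma>) (a + u') = a + (G \<sigma> u + G ({0..} - \<sigma>) u')"
      by (simp add: linear_add[OF G.lin] paste.hyps(3) co G.compl(1))
    moreover have "F \<sigma> (b + v) + F ({0..} - \<sigma>) (b + v') = b + (F \<sigma> v + F ({0..} - \<sigma>) v')"
      by (simp add: linear_add[OF F.lin] paste.hyps(3) co F.compl(1))
    ultimately show ?case
      using pasting.paste[OF paste.IH(1)[OF paste.prems] paste.IH(2)[OF paste.prems] paste.hyps(3)] by metis
  qed
  have clinear: "G \<sigma> (t *\<^sub>C x) = t *\<^sub>C G \<sigma> x" "F \<sigma> (t *\<^sub>C x) = t *\<^sub>C F \<sigma> x"
    if "\<sigma> \<in> sets borel_Rp" for \<sigma> t x
    using G.clin[OF that] F.clin[OF that] by (simp_all add: bounded_clinear_def)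
  have scale: "(t *\<^sub>C u, t *\<^sub>C v) \<in> ?P" if "(u, v) \<in> ?P" for t u v
    using that
  proof (induction rule: pasting.induct)
    case (base u v)
    then show ?case using csubspace_pair_scaleC[OF K] pasting.base by blast
  next
    case (paste u v u' v' \<sigma>)
    show ?case
      using pasting.paste[OF paste.IH paste.hyps(3)]
      by (simp add: scaleC_add_right clinear paste.hyps(3) co)
  qed
  have cP: "csubspace ?P"
    unfolding csubspace_def using zero add scale by (auto simp: zero_prod_def scaleC_prod_def)
  \<comment> \<open>This is the case \<open>\<rho> = {0..}\<close>, where both measures give the
    identity.\<close>
  have leP: "norm v \<le> sqrt c * norm u" if "(u, v) \<in> ?P" for u v
  proof -
    have "(norm v)\<^sup>2 \<le> (sqrt c * norm u)\<^sup>2"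
      using bound[OF that atLeast_0_in_borel_Rp] c by (simp add: power_mult_distrib)
    then show ?thesis by (rule power2_le_imp_le) (use c in simp)
  qed
  obtain T where T: "bounded_clinear T" "onorm T \<le> sqrt c" "\<And>u v. (u, v) \<in> ?P \<Longrightarrow> T u = v"
    "\<And>G F. orth_proj G \<Longrightarrow> bounded_linear F \<Longrightarrow> (\<And>u v. (u, v) \<in> ?P \<Longrightarrow> (G u, F v) \<in> ?P) \<Longrightarrow>
      T \<circ> G = F \<circ> T"
    using bounded_extension[OF cP leP] c by auto
  have "T \<circ> G \<sigma> = F \<sigma> \<circ> T" if s: "\<sigma> \<in> sets borel_Rp" for \<sigma>
  proof (rule T(4)[OF G.orth_proj[OF s] F.blin[OF s]])
    fix u v assume "(u, v) \<in> ?P"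
    from pasting.paste[OF this zero s] show "(G \<sigma> u, F \<sigma> v) \<in> ?P"
      by (simp add: linear_0[OF G.lin] linear_0[OF F.lin] co[OF s])
  qed
  with T(1-3) pasting.base show ?thesis by (intro that) blast+
qed

section \<open>Assembly of the equivalences\<close>

lemma graph_of_intertwine_iff:
  "graph_of T \<odot> R \<subseteq> S \<odot> graph_of T \<longleftrightarrow> (\<forall>f g. (f, g) \<in> R \<longrightarrow> (T f, T g) \<in> S)"
  by (fastforce simp: op_comp_def graph_of_def)

lemma op_app_eq: "linear_op A \<Longrightarrow> (f, g) \<in> A \<Longrightarrow> op_app A f = g"
  unfolding op_app_def linear_op_def by (rule the_equality) (auto dest: single_valuedD)

theorem theorem9p3:
  fixes A absA :: "'a::chilbert_space op_graph"
    and E :: "real set \<Rightarrow> 'a \<Rightarrow> 'a"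
    and \<phi> \<psi> :: "real \<Rightarrow> real"
    and c :: real
  assumes "\<phi> \<in> measurable borel_Rp borel_Rp"
    and "\<psi> \<in> measurable borel_Rp borel_Rp"
    and "linear_op A" and "closed A" and "densely_defined A"
    and "is_abs A absA"
    and "is_spectral_measure_of E absA"
    and "0 \<le> c"
  defines "cond_i \<equiv> \<forall>f \<in> Domain A. \<forall>\<sigma> \<in> sets borel_Rp.
      Re (cinner (E (preim \<phi> \<sigma>) (op_app absA f)) (op_app absA f))
        \<le> c * Re (cinner (E (preim \<psi> \<sigma>) (op_app A f)) (op_app A f))"
    and "cond_ii \<equiv> \<exists>T. bounded_clinear T \<and> graph_of T \<odot> A = absA \<and> onorm T \<le> sqrt c \<and>
      (\<forall>\<sigma> \<in> sets borel_Rp. T \<circ> E (preim \<psi> \<sigma>) = E (preim \<phi> \<sigma>) \<circ> T)"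
    and "cond_iii \<equiv> \<exists>T. bounded_clinear T \<and> graph_of T \<odot> A = absA \<and> onorm T \<le> sqrt c \<and>
      graph_of T \<odot> spectral_integral E \<psi> \<subseteq> spectral_integral E \<phi> \<odot> graph_of T"
  shows "(cond_i \<longleftrightarrow> cond_ii) \<and> (cond_ii \<longleftrightarrow> cond_iii)"
proof -
  interpret E: spectral E
    by unfold_locales (use assms(7) in \<open>simp add: is_spectral_measure_of_def\<close>)
  define G F where "G \<sigma> = E (preim \<psi> \<sigma>)" and "F \<sigma> = E (preim \<phi> \<sigma>)" for \<sigma>
  have sG: "spectral_measure G" and sF: "spectral_measure F"
    unfolding G_def[abs_def] F_def[abs_def]
    using E.spectral_measure_preim[OF assms(2)] E.spectral_measure_preim[OF assms(1)] by auto
  interpret G: spectral G by unfold_locales (rule sG)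
  interpret F: spectral F by unfold_locales (rule sF)
  have linP: "linear_op absA"
    using assms(6) linear_op_closed_positive_selfadjoint by (auto simp: is_abs_def)
  have dom: "Domain absA = Domain A" by (rule is_abs_Domain[OF assms(3,4,6)])
  have cond_i: "cond_i \<longleftrightarrow> (\<forall>f g h. (f, g) \<in> A \<longrightarrow> (f, h) \<in> absA \<longrightarrow>
      (\<forall>\<sigma>\<in>sets borel_Rp. (norm (F \<sigma> h))\<^sup>2 \<le> c * (norm (G \<sigma> g))\<^sup>2))" (is "_ \<longleftrightarrow> ?i")
  proof
    assume i: cond_i
    show ?i
    proof (intro allI impI ballI)
      fix f g h \<sigma> assume fg: "(f, g) \<in> A" and fh: "(f, h) \<in> absA" and s: "\<sigma> \<in> sets borel_Rp"
      have "Re (cinner (F \<sigma> h) h) \<le> c * Re (cinner (G \<sigma> g) g)"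
        using i[unfolded cond_i_def, rule_format, OF DomainI[OF fg] s]
        unfolding op_app_eq[OF assms(3) fg] op_app_eq[OF linP fh] G_def F_def .
      then show "(norm (F \<sigma> h))\<^sup>2 \<le> c * (norm (G \<sigma> g))\<^sup>2"
        unfolding F.norm_sq[OF s] G.norm_sq[OF s] .
    qed
  next
    assume i: ?i
    show cond_i
      unfolding cond_i_def
    proof (intro ballI)
      fix f \<sigma> assume f: "f \<in> Domain A" and s: "\<sigma> \<in> sets borel_Rp"
      obtain g h where fg: "(f, g) \<in> A" and fh: "(f, h) \<in> absA" using f dom by blast
      show "Re (cinner (E (preim \<phi> \<sigma>) (op_app absA f)) (op_app absA f))
        \<le> c * Re (cinner (E (preim \<psi> \<sigma>) (op_app A f)) (op_app A f))"
        using i[rule_format, OF fg fh s]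
        unfolding F.norm_sq[OF s] G.norm_sq[OF s]
        unfolding op_app_eq[OF assms(3) fg] op_app_eq[OF linP fh] G_def F_def .
    qed
  qed
  have i_ii: cond_ii if i: cond_i
  proof -
    \<comment> \<open>That \<open>|A| f\<close> depends only on \<open>A f\<close> is not known yet,
      so \<open>K\<close> is a relation; the bound in (i) will make it the graph of a bounded
      operator.\<close>
    define K where "K = {(g, h). \<exists>f. (f, g) \<in> A \<and> (f, h) \<in> absA}"
    note cA = csubspace_linear_op[OF assms(3)] and cP = csubspace_linear_op[OF linP]
    have cK: "csubspace K"
      unfolding csubspace_def
    proof (intro conjI ballI allI)
      show "0 \<in> K"
        using csubspace_pair_zero[OF cA] csubspace_pair_zero[OF cP]
        by (auto simp: K_def zero_prod_def)
    next
      fix x y assume "x \<in> K" "y \<in> K"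
      then show "x + y \<in> K"
        using csubspace_pair_add[OF cA] csubspace_pair_add[OF cP] by (fastforce simp: K_def)
    next
      fix a x assume "x \<in> K"
      then show "a *\<^sub>C x \<in> K"
        using csubspace_pair_scaleC[OF cA] csubspace_pair_scaleC[OF cP]
        by (fastforce simp: K_def scaleC_prod_def)
    qed
    have "(norm (F \<rho> v))\<^sup>2 \<le> c * (norm (G \<rho> u))\<^sup>2"
      if "(u, v) \<in> K" "\<rho> \<in> sets borel_Rp" for u v \<rho>
      using i that unfolding cond_i K_def by blast
    from spectral_bound_extension[OF sG sF cK assms(8) this]
    obtain T where T: "bounded_clinear T" "onorm T \<le> sqrt c" "\<And>u v. (u, v) \<in> K \<Longrightarrow> T u = v"
      "\<And>\<sigma>. \<sigma> \<in> sets borel_Rp \<Longrightarrow> T \<circ> G \<sigma> = F \<sigma> \<circ> T"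
      by blast
    have "graph_of T \<odot> A = absA"
    proof (intro equalityI subsetI; clarify)
      fix f h assume "(f, h) \<in> graph_of T \<odot> A"
      then obtain g where g: "(f, g) \<in> A" "h = T g" by (auto simp: op_comp_def graph_of_def)
      obtain h' where "(f, h') \<in> absA" using g(1) dom by blast
      then show "(f, h) \<in> absA" using g T(3)[of g h'] by (auto simp: K_def)
    next
      fix f h assume fh: "(f, h) \<in> absA"
      then obtain g where g: "(f, g) \<in> A" using dom by blast
      then have "T g = h" using fh by (intro T(3)) (auto simp: K_def)
      then show "(f, h) \<in> graph_of T \<odot> A" using g by (auto simp: op_comp_def graph_of_def)
    qed
    then show ?thesis
      unfolding cond_ii_def using T by (auto simp: G_def F_def)
  qed
  have ii_i: cond_i if ii: cond_ii
  proof -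
    obtain T where T: "bounded_clinear T" "graph_of T \<odot> A = absA" "onorm T \<le> sqrt c"
        "\<And>\<sigma>. \<sigma> \<in> sets borel_Rp \<Longrightarrow> T \<circ> G \<sigma> = F \<sigma> \<circ> T"
      using ii unfolding cond_ii_def G_def F_def by blast
    have blT: "bounded_linear T" using T(1) by (simp add: bounded_clinear_def)
    show ?thesis
      unfolding cond_i
    proof (intro allI impI ballI)
      fix f g h \<sigma> assume fg: "(f, g) \<in> A" and fh: "(f, h) \<in> absA" and s: "\<sigma> \<in> sets borel_Rp"
      have "(f, T g) \<in> absA" using fg T(2) by (auto simp: op_comp_def graph_of_def)
      then have "h = T g" using fh linP by (auto simp: linear_op_def dest: single_valuedD)
      \<comment> \<open>Intertwining moves \<open>T\<close> outside the projection, so the norm of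
        \<open>T\<close> alone controls the estimate.\<close>
      then have "F \<sigma> h = T (G \<sigma> g)" using T(4)[OF s] by (metis comp_apply)
      then have "norm (F \<sigma> h) \<le> sqrt c * norm (G \<sigma> g)"
        using onorm[OF blT, of "G \<sigma> g"] T(3) by (metis mult_right_mono norm_ge_zero order.trans)
      then have "(norm (F \<sigma> h))\<^sup>2 \<le> (sqrt c * norm (G \<sigma> g))\<^sup>2"
        by (intro power_mono) auto
      then show "(norm (F \<sigma> h))\<^sup>2 \<le> c * (norm (G \<sigma> g))\<^sup>2"
        using assms(8) by (simp add: power_mult_distrib)
    qed
  qed
  \<comment> \<open>The two forms of intertwining are equivalent for each bounded \<open>T\<close>
    separately; (ii) and (iii) share their remaining requirements.\<close>
  have "(\<forall>\<sigma>\<in>sets borel_Rp. T \<circ> E (preim \<psi> \<sigma>) = E (preim \<phi> \<sigma>) \<circ> T) \<longleftrightarrow>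
      graph_of T \<odot> spectral_integral E \<psi> \<subseteq> spectral_integral E \<phi> \<odot> graph_of T"
    if "bounded_clinear T" for T
  proof -
    interpret intertwining G F T
      using that by (intro intertwining.intro G.spectral_axioms F.spectral_axioms
          intertwining_axioms.intro) (simp add: bounded_clinear_def)
    have "spectral_integral E \<psi> = dyadic_limit G" "spectral_integral E \<phi> = dyadic_limit F"
      by (simp_all add: E.spectral_integral_eq_dyadic_limit assms(1,2) G_def[abs_def] F_def[abs_def])
    moreover have "(\<forall>\<sigma>\<in>sets borel_Rp. T \<circ> G \<sigma> = F \<sigma> \<circ> T) \<longleftrightarrow>
        (\<forall>f g. (f, g) \<in> dyadic_limit G \<longrightarrow> (T f, T g) \<in> dyadic_limit F)"
      using intertwine dyadic_limit_intertwine by (auto simp: fun_eq_iff)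
    ultimately show ?thesis
      by (simp add: graph_of_intertwine_iff G_def F_def)
  qed
  then have "cond_ii \<longleftrightarrow> cond_iii" unfolding cond_ii_def cond_iii_def by blast
  with i_ii ii_i show ?thesis by blast
qed

end
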